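(* Let $\{\pi_k\}_{k\ge0}$ and $\{V^{\pi_k}\}_{k\ge0}$ be the policy and value sequences generated by PMD with mirror map $h(p)=\sum_a\psi(p(a))$ and a constant step size $\eta>0$. If $\psi'(0^+)>-\infty$, $\psi'(1^-)=+\infty$, and there exists at least one state with a unique optimal action (i.e. $\mathcal S_{=1}\ne\emptyset$), then for any $\sigma\in(0,\Delta/2)$ there exist finite iterations $T_1(\sigma)$ and $T_2(\sigma)$ and finite constants $C_1(\sigma)$ and $C_2(\sigma)$ such that $$\forall\,k\ge T_1(\sigma):\quad\|V^*-V^{\pi_k}\|_\infty\le\frac{1}{(1-\gamma)^2}\,\chi^{-1}\big(k\eta(\Delta_{=1}-2\sigma)+C_1(\sigma)\big),$$ $$\forall\,k\ge T_2(\sigma):\quad\|V^*-V^{\pi_k}\|_\infty\ge\Delta\,\chi^{-1}\big(k\eta(\Delta_{=1}+2\sigma)+C_2(\sigma)\big),$$ where $\Delta_{=1}:=\min_{s\in\mathcal S_{=1}}\Delta_s$. Here $\chi(x):=\psi'(1-x)$ is a continuous and strictly decreasing function mapping $(0,1]$ onto $[\psi'(0^+),+\infty)$, and $\chi^{-1}$ denotes its inverse.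
   Context: MDP: $(\mathcal S,\mathcal A,P,r,\gamma)$ is a finite discounted Markov decision process: finite state space $\mathcal S$, finite action space $\mathcal A$, transition model $P(\cdot|s,a)\in\Delta(\mathcal S)$, reward $r:\mathcal S\times\mathcal A\to[0,1]$, discount $\gamma\in[0,1)$. $\Delta(\mathcal X)$ is the probability simplex over a finite set $\mathcal X$. A policy $\pi$ assigns to each $s$ a distribution $\pi(\cdot|s)\in\Delta(\mathcal A)$; $\Pi$ is the set of all policies. $V^\pi(s)$ is the expected value of $\sum_{t\ge0}\gamma^t r(s_t,a_t)$ given $s_0=s$, $a_t\sim\pi(\cdot|s_t)$, $s_{t+1}\sim P(\cdot|s_t,a_t)$, and $Q^\pi(s,a)$ is the same conditioned on $(s_0,a_0)=(s,a)$. $V^*(s)=\max_{\pi\in\Pi}V^\pi(s)$, $Q^*(s,a)=\max_{\pi\in\Pi}Q^\pi(s,a)$. $\mathcal A^*_s=\{a: Q^*(s,a)=V^*(s)\}$, $\mathcal S_{=1}=\{s:|\mathcal A_s^*|=1\}$, $\tilde{\mathcal S}=\{s:\mathcal A_s^*\ne\mathcal A\}$, the last assumed nonempty throughout (so $|\mathcal A|\ge2$ and $\mathcal S_{=1}\subseteq\tilde{\mathcal S}$). For $s\in\tilde{\mathcal S}$, $\Delta_s=V^*(s)-\max_{a'\notin\mathcal A_s^*}Q^*(s,a')$, and $\Delta=\min_{s\in\tilde{\mathcal S}}\Delta_s>0$ (a number; not to be confused with the simplex $\Delta(\cdot)$). Mirror map: $\psi:\mathbb R\to(-\infty,+\infty]$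 satisfies: (a) $\mathrm{dom}\,\psi\supseteq[0,1]$; (b) $\psi$ is proper, closed and convex; (c) $\psi$ is differentiable on $\mathrm{int}\,\mathrm{dom}\,\psi$ and $|\psi'(x_n)|\to\infty$ for every sequence $\{x_n\}\subseteq\mathrm{int}\,\mathrm{dom}\,\psi$ converging to a boundary point of $\mathrm{dom}\,\psi$; (d) $\psi$ is strictly convex on $\mathrm{int}\,\mathrm{dom}\,\psi$. $\psi'(0^+)$ and $\psi'(1^-)$ are the one-sided limits of $\psi'$ at $0$ from the right and at $1$ from the left. $h(p)=\sum_{a\in\mathcal A}\psi(p(a))$ and $D_h(p\|q)=h(p)-h(q)-\langle\nabla h(q),p-q\rangle$. PMD: given $\eta>0$ and an initial policy $\pi_0$ with $\pi_0(a|s)\in\mathrm{int}\,\mathrm{dom}\,\psi$ for all $(s,a)$ (assumed throughout), for each $s$, $\pi_{k+1}(\cdot|s)=\arg\max_{p\in\Delta(\mathcal A)}\{\eta\langle p,Q^{\pi_k}(s,\cdot)\rangle-D_h(p\|\pi_k(\cdot|s))\}$; all iterates satisfy $\pi_k(a|s)\in\mathrm{int}\,\mathrm{dom}\,\psi$. *)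

theory Defs
  imports "HOL-Probability.Probability"
begin

section \<open>Finite discounted Markov decision processes\<close>

text \<open>The simplex over a finite set is rendered as the type of probability mass functions over a
  finite type.  The rewards and the discount factor enter as plain parameters; their ranges are
  hypotheses of the theorem.\<close>

type_synonym ('s, 'a) policy = "'s \<Rightarrow> 'a pmf"

definition next_pair ::
  "('s \<Rightarrow> 'a \<Rightarrow> 's pmf) \<Rightarrow> ('s, 'a) policy \<Rightarrow> 's \<times> 'a \<Rightarrow> ('s \<times> 'a) pmf" where
  "next_pair P \<pi> x =
     bind_pmf (P (fst x) (snd x)) (\<lambda>s'. map_pmf (\<lambda>a'. (s', a')) (\<pi> s'))"

text \<open>Law of the pair at time \<open>i\<close> given the pairs \<open>\<omega> 0, \<dots>, \<omega> (i - 1)\<close>, in the form required by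
  the locale \<open>Ionescu_Tulcea\<close>.\<close>

definition pair_kernel ::
  "('s \<Rightarrow> 'a \<Rightarrow> 's pmf) \<Rightarrow> ('s, 'a) policy \<Rightarrow> ('s \<times> 'a) pmf \<Rightarrow>
   nat \<Rightarrow> (nat \<Rightarrow> 's \<times> 'a) \<Rightarrow> ('s \<times> 'a) measure" where
  "pair_kernel P \<pi> \<mu> i \<omega> =
     measure_pmf (case i of 0 \<Rightarrow> \<mu> | Suc j \<Rightarrow> next_pair P \<pi> (\<omega> j))"

text \<open>The law of the whole trajectory \<open>((s\<^sub>0, a\<^sub>0), (s\<^sub>1, a\<^sub>1), \<dots>)\<close> whose first pair is
  distributed according to \<open>\<mu>\<close>.\<close>

definition trajectory_measure ::
  "('s \<Rightarrow> 'a \<Rightarrow> 's pmf) \<Rightarrow> ('s, 'a) policy \<Rightarrow> ('s \<times> 'a) pmf \<Rightarrow> (nat \<Rightarrow> 's \<times> 'a) measure" where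
  "trajectory_measure P \<pi> \<mu> =
     projective_family.lim UNIV
       (Ionescu_Tulcea.CI (pair_kernel P \<pi> \<mu>) (\<lambda>_. count_space UNIV)) (\<lambda>_. count_space UNIV)"

lemma Ionescu_Tulcea_pair_kernel:
  fixes P :: "'s::finite \<Rightarrow> 'a::finite \<Rightarrow> 's pmf"
  shows "Ionescu_Tulcea (pair_kernel P \<pi> \<mu>) (\<lambda>_. count_space UNIV)"
proof (rule Ionescu_Tulcea.intro)
  fix i
  show "pair_kernel P \<pi> \<mu> i \<in> measurable (PiM {0..<i} (\<lambda>_. count_space UNIV))
          (subprob_algebra (count_space UNIV))"
  proof (cases i)
    case 0
    then show ?thesis
      by (simp add: pair_kernel_def[abs_def] measure_pmf_in_subprob_algebra)
  next
    case (Suc j)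
    have "(\<lambda>\<omega>. \<omega> j) \<in> measurable (PiM {0..<i} (\<lambda>_. count_space (UNIV :: ('s \<times> 'a) set)))
            (count_space UNIV)"
      by (rule measurable_component_singleton) (simp add: Suc)
    moreover have "(\<lambda>x. measure_pmf (next_pair P \<pi> x)) \<in> measurable (count_space UNIV)
            (subprob_algebra (count_space UNIV))"
      by (simp add: measure_pmf_in_subprob_algebra)
    ultimately show ?thesis
      unfolding pair_kernel_def[abs_def] Suc nat.case by (rule measurable_compose)
  qed
qed (simp add: pair_kernel_def measure_pmf.prob_space_axioms)

definition discounted_return :: "('s \<Rightarrow> 'a \<Rightarrow> real) \<Rightarrow> real \<Rightarrow> (nat \<Rightarrow> 's \<times> 'a) \<Rightarrow> real" where
  "discounted_return r \<gamma> \<omega> = (\<Sum>t. \<gamma> ^ t * r (fst (\<omega> t)) (snd (\<omega> t)))"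

definition V_fun ::
  "('s \<Rightarrow> 'a \<Rightarrow> 's pmf) \<Rightarrow> ('s \<Rightarrow> 'a \<Rightarrow> real) \<Rightarrow> real \<Rightarrow> ('s, 'a) policy \<Rightarrow> 's \<Rightarrow> real" where
  "V_fun P r \<gamma> \<pi> s =
     integral\<^sup>L (trajectory_measure P \<pi> (map_pmf (\<lambda>a. (s, a)) (\<pi> s))) (discounted_return r \<gamma>)"

definition Q_fun ::
  "('s \<Rightarrow> 'a \<Rightarrow> 's pmf) \<Rightarrow> ('s \<Rightarrow> 'a \<Rightarrow> real) \<Rightarrow> real \<Rightarrow> ('s, 'a) policy \<Rightarrow> 's \<Rightarrow> 'a \<Rightarrow> real" where
  "Q_fun P r \<gamma> \<pi> s a =
     integral\<^sup>L (trajectory_measure P \<pi> (return_pmf (s, a))) (discounted_return r \<gamma>)"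

definition V_opt ::
  "('s \<Rightarrow> 'a \<Rightarrow> 's pmf) \<Rightarrow> ('s \<Rightarrow> 'a \<Rightarrow> real) \<Rightarrow> real \<Rightarrow> 's \<Rightarrow> real" where
  "V_opt P r \<gamma> s = (SUP \<pi>. V_fun P r \<gamma> \<pi> s)"

definition Q_opt ::
  "('s \<Rightarrow> 'a \<Rightarrow> 's pmf) \<Rightarrow> ('s \<Rightarrow> 'a \<Rightarrow> real) \<Rightarrow> real \<Rightarrow> 's \<Rightarrow> 'a \<Rightarrow> real" where
  "Q_opt P r \<gamma> s a = (SUP \<pi>. Q_fun P r \<gamma> \<pi> s a)"

definition opt_actions ::
  "('s \<Rightarrow> 'a \<Rightarrow> 's pmf) \<Rightarrow> ('s \<Rightarrow> 'a \<Rightarrow> real) \<Rightarrow> real \<Rightarrow> 's \<Rightarrow> 'a set" where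
  "opt_actions P r \<gamma> s = {a. Q_opt P r \<gamma> s a = V_opt P r \<gamma> s}"

text \<open>The sets written \<open>\<S>\<^sub>=\<^sub>1\<close> and \<open>\<S>\<close> with a tilde.\<close>

definition unique_opt_states ::
  "('s \<Rightarrow> 'a \<Rightarrow> 's pmf) \<Rightarrow> ('s \<Rightarrow> 'a \<Rightarrow> real) \<Rightarrow> real \<Rightarrow> 's set" where
  "unique_opt_states P r \<gamma> = {s. card (opt_actions P r \<gamma> s) = 1}"

definition nontrivial_states ::
  "('s \<Rightarrow> 'a \<Rightarrow> 's pmf) \<Rightarrow> ('s \<Rightarrow> 'a \<Rightarrow> real) \<Rightarrow> real \<Rightarrow> 's set" where
  "nontrivial_states P r \<gamma> = {s. opt_actions P r \<gamma> s \<noteq> UNIV}"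

definition state_gap ::
  "('s \<Rightarrow> 'a \<Rightarrow> 's pmf) \<Rightarrow> ('s \<Rightarrow> 'a \<Rightarrow> real) \<Rightarrow> real \<Rightarrow> 's \<Rightarrow> real" where
  "state_gap P r \<gamma> s = V_opt P r \<gamma> s - Max (Q_opt P r \<gamma> s ` (- opt_actions P r \<gamma> s))"

definition gap ::
  "('s \<Rightarrow> 'a \<Rightarrow> 's pmf) \<Rightarrow> ('s \<Rightarrow> 'a \<Rightarrow> real) \<Rightarrow> real \<Rightarrow> real" where
  "gap P r \<gamma> = Min (state_gap P r \<gamma> ` nontrivial_states P r \<gamma>)"

definition unique_gap ::
  "('s \<Rightarrow> 'a \<Rightarrow> 's pmf) \<Rightarrow> ('s \<Rightarrow> 'a \<Rightarrow> real) \<Rightarrow> real \<Rightarrow> real" where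
  "unique_gap P r \<gamma> = Min (state_gap P r \<gamma> ` unique_opt_states P r \<gamma>)"

definition max_norm :: "('s::finite \<Rightarrow> real) \<Rightarrow> real" where
  "max_norm f = Max (range (\<lambda>s. \<bar>f s\<bar>))"


section \<open>Mirror maps\<close>

definition eff_dom :: "(real \<Rightarrow> ereal) \<Rightarrow> real set" where
  "eff_dom \<psi> = {x. \<psi> x < \<infinity>}"

definition psi_deriv :: "(real \<Rightarrow> ereal) \<Rightarrow> real \<Rightarrow> real" where
  "psi_deriv \<psi> x = deriv (\<lambda>t. real_of_ereal (\<psi> t)) x"

definition ext_epigraph :: "(real \<Rightarrow> ereal) \<Rightarrow> (real \<times> real) set" where
  "ext_epigraph \<psi> = {(x, t). \<psi> x \<le> ereal t}"

text \<open>Convexity and closedness of an extended-valued function are those of its epigraph.\<close>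

definition mirror_potential :: "(real \<Rightarrow> ereal) \<Rightarrow> bool" where
  "mirror_potential \<psi> \<longleftrightarrow>
     {0..1} \<subseteq> eff_dom \<psi> \<and>
     (\<forall>x. \<psi> x \<noteq> -\<infinity>) \<and> (\<exists>x. \<psi> x \<noteq> \<infinity>) \<and>
     closed (ext_epigraph \<psi>) \<and> convex (ext_epigraph \<psi>) \<and>
     (\<lambda>x. real_of_ereal (\<psi> x)) differentiable_on interior (eff_dom \<psi>) \<and>
     (\<forall>X x. (\<forall>n. X n \<in> interior (eff_dom \<psi>)) \<and> X \<longlonglongrightarrow> x \<and> x \<in> frontier (eff_dom \<psi>) \<longrightarrow>
        filterlim (\<lambda>n. \<bar>psi_deriv \<psi> (X n)\<bar>) at_top sequentially) \<and>
     (\<forall>x\<in>interior (eff_dom \<psi>). \<forall>y\<in>interior (eff_dom \<psi>). \<forall>t.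
        x \<noteq> y \<and> 0 < t \<and> t < 1 \<longrightarrow>
        \<psi> ((1 - t) * x + t * y) < ereal (1 - t) * \<psi> x + ereal t * \<psi> y)"

definition psi_deriv_0p :: "(real \<Rightarrow> ereal) \<Rightarrow> ereal" where
  "psi_deriv_0p \<psi> = Lim (at_right 0) (\<lambda>x. ereal (psi_deriv \<psi> x))"

definition psi_deriv_1m :: "(real \<Rightarrow> ereal) \<Rightarrow> ereal" where
  "psi_deriv_1m \<psi> = Lim (at_left 1) (\<lambda>x. ereal (psi_deriv \<psi> x))"

definition mirror_map :: "(real \<Rightarrow> ereal) \<Rightarrow> real ^ 'a \<Rightarrow> ereal" where
  "mirror_map \<psi> p = (\<Sum>a\<in>UNIV. \<psi> (p $ a))"

definition grad :: "(real ^ 'a \<Rightarrow> ereal) \<Rightarrow> real ^ 'a \<Rightarrow> real ^ 'a" where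
  "grad h q = (THE D. GDERIV (\<lambda>x. real_of_ereal (h x)) q :> D)"

definition bregman :: "(real ^ 'a \<Rightarrow> ereal) \<Rightarrow> real ^ 'a \<Rightarrow> real ^ 'a \<Rightarrow> ereal" where
  "bregman h p q = h p - h q - ereal (grad h q \<bullet> (p - q))"

definition chi :: "(real \<Rightarrow> ereal) \<Rightarrow> real \<Rightarrow> real" where
  "chi \<psi> x = psi_deriv \<psi> (1 - x)"

definition chi_inv :: "(real \<Rightarrow> ereal) \<Rightarrow> real \<Rightarrow> real" where
  "chi_inv \<psi> = inv_into {0<..1} (chi \<psi>)"


section \<open>Policy mirror descent\<close>

definition pmf_vec :: "'a::finite pmf \<Rightarrow> real ^ 'a" where
  "pmf_vec p = (\<chi> a. pmf p a)"

definition pmd_objective ::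
  "('s \<Rightarrow> 'a::finite \<Rightarrow> 's pmf) \<Rightarrow> ('s \<Rightarrow> 'a \<Rightarrow> real) \<Rightarrow> real \<Rightarrow> (real \<Rightarrow> ereal) \<Rightarrow> real \<Rightarrow>
   ('s, 'a) policy \<Rightarrow> 's \<Rightarrow> 'a pmf \<Rightarrow> ereal" where
  "pmd_objective P r \<gamma> \<psi> \<eta> \<pi> s p =
     ereal (\<eta> * (pmf_vec p \<bullet> (\<chi> a. Q_fun P r \<gamma> \<pi> s a)))
       - bregman (mirror_map \<psi>) (pmf_vec p) (pmf_vec (\<pi> s))"

definition pmd_sequence ::
  "('s \<Rightarrow> 'a::finite \<Rightarrow> 's pmf) \<Rightarrow> ('s \<Rightarrow> 'a \<Rightarrow> real) \<Rightarrow> real \<Rightarrow> (real \<Rightarrow> ereal) \<Rightarrow> real \<Rightarrow>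
   (nat \<Rightarrow> ('s, 'a) policy) \<Rightarrow> bool" where
  "pmd_sequence P r \<gamma> \<psi> \<eta> \<pi> \<longleftrightarrow>
     (\<forall>s a. pmf (\<pi> 0 s) a \<in> interior (eff_dom \<psi>)) \<and>
     (\<forall>k s. is_arg_max (pmd_objective P r \<gamma> \<psi> \<eta> (\<pi> k) s) (\<lambda>_. True) (\<pi> (Suc k) s))"

end

theory Submission
  imports Defs
begin

text \<open>The proof reads policy mirror descent in dual coordinates.  Write \<open>z k s a = \<psi>' (\<pi> k s a)\<close>.
The optimality conditions of one step (\<open>pmd_step\<close>) say that at every state there is a
multiplier \<open>l\<close> with
  \<open>z (Suc k) s a = max (\<psi>' 0) (z k s a + \<eta> * Q (\<pi> k) s a - l)\<close>
for all actions \<open>a\<close>: the dual variables follow the action values at speed \<open>\<eta>\<close>, up to a common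
shift that keeps the total probability equal to one, and they are cut off at \<open>\<psi>' 0\<close>.  The two
hypotheses on \<open>\<psi>'\<close> are what makes this picture right: a finite \<open>\<psi>' 0\<close> lets
probabilities reach zero, and \<open>\<psi>' 1 = \<infinity>\<close> keeps them below one.

The values converge to the optimal values for a qualitative reason.  They increase along the
iteration, and if some action \<open>b\<close> had a limiting action value above the limiting value of its
state, then the Bregman divergence from the policy to the point mass at \<open>b\<close> would decrease by a
fixed amount at every late step, although it is nonnegative.  So the limit satisfies the Bellman
inequality and is optimal (\<open>V_tendsto\<close>), and the probabilities of suboptimal actions tend to zero.

Two mechanisms then decide the rate.  At a state with at least two optimal actions some optimal
action has probability at most one half, so the modulus of continuity of \<open>\<psi>'\<close> on
\<open>[0, 3/4]\<close> turns a dual increment into a probability increment.  Hence the multiplier cannot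
stay far below the optimal value, the dual variable of each suboptimal action falls at
least at a constant speed, and its probability is exactly zero after finitely many steps (\<open>subopt_eliminated\<close>).  At
a state with one optimal action \<open>b\<close> the probability of \<open>b\<close> stays below one, so after every
step some suboptimal action has positive probability although all suboptimal dual variables tend
to \<open>\<psi>' 0\<close>.  This pins the multiplier to \<open>\<eta>\<close> times the second best action value, and
\<open>z k s b\<close> grows at speed \<open>\<eta> * \<Delta>\<^sub>s\<close> up to any prescribed error (\<open>unique_opt_increment\<close>).  The
suboptimal mass at such a state is \<open>chi_inv \<psi> (z k s b)\<close>.

Finally the value error is comparable with the suboptimal mass: it is at most
\<open>1 / (1 - \<gamma>)\<^sup>2\<close> times the largest mass over all states (\<open>value_gap_upper\<close>) and at least the
gap of a state times its mass (\<open>value_gap_lower\<close>).  The slowest state with a unique optimal action,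
the one with gap \<open>\<Delta>\<^sub>=\<^sub>1\<close>, dictates both bounds.\<close>

section \<open>Bellman equations for the trajectory measure\<close>

primrec pair_law ::
  "('s \<Rightarrow> 'a \<Rightarrow> 's pmf) \<Rightarrow> ('s, 'a) policy \<Rightarrow> ('s \<times> 'a) pmf \<Rightarrow> nat \<Rightarrow> ('s \<times> 'a) pmf" where
  "pair_law P \<pi> \<mu> 0 = \<mu>"
| "pair_law P \<pi> \<mu> (Suc t) = bind_pmf (pair_law P \<pi> \<mu> t) (next_pair P \<pi>)"

lemma pair_law_Suc_shift: "pair_law P \<pi> \<mu> (Suc t) = pair_law P \<pi> (bind_pmf \<mu> (next_pair P \<pi>)) t"
  by (induction t) auto

lemma pair_law_bind: "pair_law P \<pi> \<mu> t = bind_pmf \<mu> (\<lambda>x. pair_law P \<pi> (return_pmf x) t)"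
  by (induction t) (auto simp: bind_return_pmf' bind_assoc_pmf)

text \<open>The trajectory measure is a projective limit of iterated kernel extensions.  Its
restriction to the first \<open>Suc n\<close> coordinates is one of these extensions, whose last coordinate is
distributed according to the kernel integrated against the earlier ones; by induction the marginals
are the laws of the Markov chain of pairs.\<close>

lemma trajectory_marginal:
  fixes P :: "'s::finite \<Rightarrow> 'a::finite \<Rightarrow> 's pmf"
  shows "distr (trajectory_measure P \<pi> \<mu>) (count_space UNIV) (\<lambda>\<omega>. \<omega> t) =
           measure_pmf (pair_law P \<pi> \<mu> t)"
    and "prob_space (trajectory_measure P \<pi> \<mu>)"
    and "sets (trajectory_measure P \<pi> \<mu>) = sets (PiM UNIV (\<lambda>_. count_space UNIV))"
proof -
  let ?M = "\<lambda>_::nat. count_space (UNIV :: ('s \<times> 'a) set)"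
  let ?u = "\<lambda>_::nat. undefined :: 's \<times> 'a"
  interpret IT: Ionescu_Tulcea "pair_kernel P \<pi> \<mu>" ?M
    by (rule Ionescu_Tulcea_pair_kernel)
  have lim: "trajectory_measure P \<pi> \<mu> = IT.PF.lim"
    by (simp add: trajectory_measure_def)
  show sets: "sets (trajectory_measure P \<pi> \<mu>) = sets (PiM UNIV ?M)"
    unfolding lim by (rule IT.PF.sets_lim)
  have u: "?u \<in> space (PiM {0..<0} ?M)"
    by (simp add: space_PiM)
  have sC: "sets (IT.C 0 n ?u) = sets (PiM {0..<n} ?M)" for n
    using IT.sets_C[OF u, of n] by simp
  have ne: "space (IT.C 0 n ?u) \<noteq> {}" for n
    using IT.prob_space_C[OF u, of n] by (rule prob_space.not_empty)
  have up: "IT.up_to {0..<n} = n" for n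
    unfolding IT.up_to_def by (rule Least_equality) (auto simp: not_less_eq_eq intro: ccontr)
  have fin: "distr IT.PF.lim (PiM {0..<n} ?M) (\<lambda>x. restrict x {0..<n}) = IT.C 0 n ?u" for n
  proof -
    have "distr IT.PF.lim (PiM {0..<n} ?M) (\<lambda>x. restrict x {0..<n}) = IT.CI {0..<n}"
      by (rule IT.distr_lim) simp
    also have "\<dots> = IT.C 0 n ?u"
      unfolding IT.CI_def up using IT.distr_C[of n n ?u 0] u by simp
    finally show ?thesis .
  qed
  show "prob_space (trajectory_measure P \<pi> \<mu>)"
  proof -
    have "prob_space (distr IT.PF.lim (PiM {0..<0} ?M) (\<lambda>x. restrict x {0..<0}))"
      unfolding fin by (rule IT.prob_space_C[OF u])
    then show ?thesis
      unfolding lim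
      by (rule prob_space_distrD[rotated])
         (auto simp: measurable_cong_sets[OF IT.PF.sets_lim refl] intro!: measurable_restrict)
  qed
  have marg: "distr (trajectory_measure P \<pi> \<mu>) (count_space UNIV) (\<lambda>\<omega>. \<omega> n) =
                distr (IT.C 0 (Suc n) ?u) (count_space UNIV) (\<lambda>\<omega>. \<omega> n)" for n
    unfolding fin[symmetric] lim
    by (subst distr_distr)
       (auto simp: measurable_cong_sets[OF IT.PF.sets_lim refl] comp_def
             intro!: measurable_restrict measurable_component_singleton)
  have last: "distr (IT.C 0 (Suc n) ?u) (count_space UNIV) (\<lambda>\<omega>. \<omega> n) =
                IT.C 0 n ?u \<bind> pair_kernel P \<pi> \<mu> n" for n
  proof -
    have "distr (IT.C 0 (Suc n) ?u) (count_space UNIV) (\<lambda>\<omega>. \<omega> n) =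
            IT.C 0 n ?u \<bind> (\<lambda>x. distr (IT.eP n x) (count_space UNIV) (\<lambda>\<omega>. \<omega> n))"
      using ne[of n]
      by (simp, subst distr_bind[where K = "PiM {0..<Suc n} ?M"])
         (auto simp: measurable_cong_sets[OF sC refl] IT.measurable_eP
               intro: measurable_component_singleton)
    also have "\<dots> = IT.C 0 n ?u \<bind> pair_kernel P \<pi> \<mu> n"
    proof (intro bind_cong refl)
      fix x assume "x \<in> space (IT.C 0 n ?u)"
      then have x: "x \<in> space (PiM {0..<n} ?M)"
        using sets_eq_imp_space_eq[OF sC] by blast
      have [measurable]: "fun_upd x n \<in> measurable (pair_kernel P \<pi> \<mu> n x) (PiM {0..<Suc n} ?M)"
        unfolding pair_kernel_def
        using x by (auto simp: space_PiM PiE_iff extensional_def)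
      show "distr (IT.eP n x) (count_space UNIV) (\<lambda>\<omega>. \<omega> n) = pair_kernel P \<pi> \<mu> n x"
        unfolding IT.eP_def
        by (subst distr_distr)
           (use x in \<open>auto simp: comp_def pair_kernel_def space_PiM PiE_iff extensional_def
                 intro: measurable_component_singleton
                 intro!: distr_id2\<close>)
    qed
    finally show ?thesis .
  qed
  show "distr (trajectory_measure P \<pi> \<mu>) (count_space UNIV) (\<lambda>\<omega>. \<omega> t) =
           measure_pmf (pair_law P \<pi> \<mu> t)"
  proof (induction t)
    case 0
    show ?case
      unfolding marg last using IT.P[of 0] u
      by (simp, subst bind_return) (auto simp: pair_kernel_def)
  next
    case (Suc t)
    have "distr (trajectory_measure P \<pi> \<mu>) (count_space UNIV) (\<lambda>\<omega>. \<omega> (Suc t)) =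
            IT.C 0 (Suc t) ?u \<bind> (\<lambda>\<omega>. measure_pmf (next_pair P \<pi> (\<omega> t)))"
      unfolding marg last by (simp add: pair_kernel_def[abs_def])
    also have "\<dots> = distr (IT.C 0 (Suc t) ?u) (count_space UNIV) (\<lambda>\<omega>. \<omega> t) \<bind>
                      (\<lambda>x. measure_pmf (next_pair P \<pi> x))"
      by (rule bind_distr[symmetric, where K = "count_space UNIV"])
         (use ne in \<open>auto simp: measurable_cong_sets[OF sC refl] measure_pmf_in_subprob_algebra
               simp del: IT.C.simps intro: measurable_component_singleton\<close>)
    also have "\<dots> = measure_pmf (pair_law P \<pi> \<mu> (Suc t))"
      using Suc by (simp add: marg[symmetric] measure_pmf_bind del: IT.C.simps)
    finally show ?case .
  qed
qed

definition expected_return ::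
  "('s \<Rightarrow> 'a \<Rightarrow> 's pmf) \<Rightarrow> ('s \<Rightarrow> 'a \<Rightarrow> real) \<Rightarrow> real \<Rightarrow> ('s, 'a) policy \<Rightarrow> ('s \<times> 'a) pmf \<Rightarrow> real" where
  "expected_return P r \<gamma> \<pi> \<mu> = integral\<^sup>L (trajectory_measure P \<pi> \<mu>) (discounted_return r \<gamma>)"

text \<open>Rewards are bounded because the pair space is finite, so the geometric
factor dominates the series and expectation and summation may be exchanged.  This reduces
expected returns to the marginals of the trajectory.\<close>

lemma expected_return_sums:
  fixes P :: "'s::finite \<Rightarrow> 'a::finite \<Rightarrow> 's pmf"
  assumes \<gamma>: "0 \<le> \<gamma>" "\<gamma> < 1"
  shows "(\<lambda>t. \<gamma> ^ t * measure_pmf.expectation (pair_law P \<pi> \<mu> t) (\<lambda>x. r (fst x) (snd x)))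
           sums expected_return P r \<gamma> \<pi> \<mu>"
proof -
  let ?L = "trajectory_measure P \<pi> \<mu>"
  let ?r = "\<lambda>x. r (fst x) (snd x)"
  interpret prob_space ?L by (rule trajectory_marginal)
  have [measurable]: "(\<lambda>\<omega>. \<omega> t) \<in> measurable ?L (count_space UNIV)" for t
    unfolding measurable_cong_sets[OF trajectory_marginal(3) refl]
    by (rule measurable_component_singleton) simp
  define B where "B = Max (range (\<lambda>x. \<bar>?r x\<bar>))"
  have B: "\<bar>?r x\<bar> \<le> B" for x
    unfolding B_def by (rule Max_ge) auto
  have m: "(\<lambda>\<omega>. ?r (\<omega> t)) \<in> borel_measurable ?L" for t
    by (rule measurable_compose[where N = "count_space UNIV" and f = "\<lambda>\<omega>. \<omega> t"]) auto
  have int: "integrable ?L (\<lambda>\<omega>. ?r (\<omega> t))" for t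
    by (rule integrable_const_bound[of _ B]) (auto intro: B m)
  have sb: "summable (\<lambda>t. \<gamma> ^ t * B)"
    using \<gamma> by (intro summable_mult2 summable_geometric) simp
  have bd: "norm (\<gamma> ^ t * ?r x) \<le> \<gamma> ^ t * B" for t x
    using B \<gamma> by (auto simp: abs_mult intro: mult_left_mono)
  have "(\<lambda>t. integral\<^sup>L ?L (\<lambda>\<omega>. \<gamma> ^ t * ?r (\<omega> t))) sums
          integral\<^sup>L ?L (\<lambda>\<omega>. \<Sum>t. \<gamma> ^ t * ?r (\<omega> t))"
  proof (rule sums_integral)
    show "integrable ?L (\<lambda>\<omega>. \<gamma> ^ t * ?r (\<omega> t))" for t
      using int by simp
    show "AE \<omega> in ?L. summable (\<lambda>t. norm (\<gamma> ^ t * ?r (\<omega> t)))"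
      by (intro AE_I2 summable_comparison_test[OF _ sb]) (use bd in auto)
    show "summable (\<lambda>t. LINT \<omega>|?L. norm (\<gamma> ^ t * ?r (\<omega> t)))"
    proof (intro summable_comparison_test[OF _ sb] exI allI impI)
      fix t
      have "(LINT \<omega>|?L. norm (\<gamma> ^ t * ?r (\<omega> t))) \<le> (LINT \<omega>|?L. \<gamma> ^ t * B)"
        by (intro integral_mono integrable_norm integrable_mult_right int bd) simp
      then show "norm (LINT \<omega>|?L. norm (\<gamma> ^ t * ?r (\<omega> t))) \<le> \<gamma> ^ t * B"
        by (simp add: prob_space)
    qed
  qed
  moreover have "integral\<^sup>L ?L (\<lambda>\<omega>. ?r (\<omega> t)) =
                   measure_pmf.expectation (pair_law P \<pi> \<mu> t) ?r" for t
    using integral_distr[of "\<lambda>\<omega>. \<omega> t" ?L "count_space UNIV" ?r]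
    by (simp add: trajectory_marginal(1))
  ultimately show ?thesis
    by (simp add: expected_return_def discounted_return_def[abs_def])
qed

lemma expected_return_mixture:
  fixes P :: "'s::finite \<Rightarrow> 'a::finite \<Rightarrow> 's pmf"
  assumes \<gamma>: "0 \<le> \<gamma>" "\<gamma> < 1"
  shows "expected_return P r \<gamma> \<pi> \<mu> = (\<Sum>x\<in>UNIV. pmf \<mu> x * expected_return P r \<gamma> \<pi> (return_pmf x))"
proof -
  let ?E = "\<lambda>\<mu> t. measure_pmf.expectation (pair_law P \<pi> \<mu> t) (\<lambda>x. r (fst x) (snd x))"
  have "(\<lambda>t. \<Sum>x\<in>UNIV. pmf \<mu> x * (\<gamma> ^ t * ?E (return_pmf x) t)) sums
          (\<Sum>x\<in>UNIV. pmf \<mu> x * expected_return P r \<gamma> \<pi> (return_pmf x))"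
    by (intro sums_sum sums_mult expected_return_sums[OF \<gamma>])
  moreover have "(\<Sum>x\<in>UNIV. pmf \<mu> x * (\<gamma> ^ t * ?E (return_pmf x) t)) = \<gamma> ^ t * ?E \<mu> t" for t
    by (subst (2) pair_law_bind, subst pmf_expectation_bind[of UNIV])
       (auto simp: sum_distrib_left mult_ac)
  ultimately show ?thesis
    using expected_return_sums[OF \<gamma>, of P \<pi> \<mu> r] sums_unique2 by (metis (no_types, lifting) ext)
qed

text \<open>Splitting off the first term of the series leaves the return of the chain
started one step later; this is the source of the Bellman equations below.\<close>

lemma expected_return_step:
  fixes P :: "'s::finite \<Rightarrow> 'a::finite \<Rightarrow> 's pmf"
  assumes \<gamma>: "0 \<le> \<gamma>" "\<gamma> < 1"
  shows "expected_return P r \<gamma> \<pi> (return_pmf x) =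
           r (fst x) (snd x) + \<gamma> * expected_return P r \<gamma> \<pi> (next_pair P \<pi> x)"
proof -
  let ?E = "\<lambda>\<mu> t. measure_pmf.expectation (pair_law P \<pi> \<mu> t) (\<lambda>x. r (fst x) (snd x))"
  have "(\<lambda>t. \<gamma> ^ Suc t * ?E (return_pmf x) (Suc t)) sums
          (expected_return P r \<gamma> \<pi> (return_pmf x) - \<gamma> ^ 0 * ?E (return_pmf x) 0)"
    using expected_return_sums[OF \<gamma>, of P \<pi> "return_pmf x" r] by (subst sums_Suc_iff) simp
  moreover have "?E (return_pmf x) (Suc t) = ?E (next_pair P \<pi> x) t" for t
    unfolding pair_law_Suc_shift by (simp add: bind_return_pmf)
  ultimately have "(\<lambda>t. \<gamma> * (\<gamma> ^ t * ?E (next_pair P \<pi> x) t)) sums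
          (expected_return P r \<gamma> \<pi> (return_pmf x) - r (fst x) (snd x))"
    by (simp add: mult_ac)
  moreover have "(\<lambda>t. \<gamma> * (\<gamma> ^ t * ?E (next_pair P \<pi> x) t)) sums
          (\<gamma> * expected_return P r \<gamma> \<pi> (next_pair P \<pi> x))"
    by (intro sums_mult expected_return_sums[OF \<gamma>])
  ultimately show ?thesis
    using sums_unique2 by fastforce
qed

lemma V_fun_eq:
  fixes P :: "'s::finite \<Rightarrow> 'a::finite \<Rightarrow> 's pmf"
  assumes \<gamma>: "0 \<le> \<gamma>" "\<gamma> < 1"
  shows "V_fun P r \<gamma> \<pi> s = (\<Sum>a\<in>UNIV. pmf (\<pi> s) a * Q_fun P r \<gamma> \<pi> s a)"
proof -
  have "V_fun P r \<gamma> \<pi> s = measure_pmf.expectation (map_pmf (\<lambda>a. (s, a)) (\<pi> s))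
          (\<lambda>x. expected_return P r \<gamma> \<pi> (return_pmf x))"
    unfolding V_fun_def expected_return_def[symmetric]
    by (subst expected_return_mixture[OF \<gamma>], subst integral_measure_pmf[of UNIV]) auto
  also have "\<dots> = (\<Sum>a\<in>UNIV. pmf (\<pi> s) a * Q_fun P r \<gamma> \<pi> s a)"
    by (simp, subst integral_measure_pmf[of UNIV])
       (auto simp: Q_fun_def expected_return_def)
  finally show ?thesis .
qed

lemma Q_fun_eq:
  fixes P :: "'s::finite \<Rightarrow> 'a::finite \<Rightarrow> 's pmf"
  assumes \<gamma>: "0 \<le> \<gamma>" "\<gamma> < 1"
  shows "Q_fun P r \<gamma> \<pi> s a = r s a + \<gamma> * (\<Sum>s'\<in>UNIV. pmf (P s a) s' * V_fun P r \<gamma> \<pi> s')"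
proof -
  have "expected_return P r \<gamma> \<pi> (next_pair P \<pi> (s, a)) =
          measure_pmf.expectation (next_pair P \<pi> (s, a))
            (\<lambda>x. expected_return P r \<gamma> \<pi> (return_pmf x))"
    by (subst expected_return_mixture[OF \<gamma>], subst integral_measure_pmf[of UNIV]) auto
  also have "\<dots> = (\<Sum>s'\<in>UNIV. pmf (P s a) s' * measure_pmf.expectation (map_pmf (\<lambda>a. (s', a)) (\<pi> s'))
            (\<lambda>x. expected_return P r \<gamma> \<pi> (return_pmf x)))"
    unfolding next_pair_def by (subst pmf_expectation_bind[of UNIV]) auto
  also have "\<dots> = (\<Sum>s'\<in>UNIV. pmf (P s a) s' * V_fun P r \<gamma> \<pi> s')"
    unfolding V_fun_def expected_return_def[symmetric]
    by (subst (2) expected_return_mixture[OF \<gamma>], subst integral_measure_pmf[of UNIV]) auto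
  finally show ?thesis
    using expected_return_step[OF \<gamma>, of P r \<pi> "(s, a)"]
    by (simp add: Q_fun_def expected_return_def)
qed

section \<open>The derivative of the mirror map\<close>

text \<open>The properties of the mirror map that the analysis uses, for real functions: \<open>d\<close> is the
derivative of the convex function \<open>f\<close> on \<open>[0, 1)\<close>, expressed by tangent lines.\<close>

locale mirror_derivative =
  fixes f d :: "real \<Rightarrow> real"
  assumes tangent: "\<And>x y. 0 \<le> x \<Longrightarrow> x < 1 \<Longrightarrow> 0 \<le> y \<Longrightarrow> y \<le> 1 \<Longrightarrow> f x + d x * (y - x) \<le> f y"
    and d_cont: "continuous_on {0..<1} d"
    and d_strict: "strict_mono_on {0..<1} d"
    and d_blowup: "filterlim d at_top (at_left 1)"

context mirror_derivative
begin

lemma d_mono: "0 \<le> x \<Longrightarrow> x \<le> y \<Longrightarrow> y < 1 \<Longrightarrow> d x \<le> d y"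
  using strict_mono_on_leD[OF d_strict, of x y] by auto

lemma d_less_iff: "0 \<le> x \<Longrightarrow> x < 1 \<Longrightarrow> 0 \<le> y \<Longrightarrow> y < 1 \<Longrightarrow> d x < d y \<longleftrightarrow> x < y"
  using strict_mono_on_less[OF d_strict, of x y] by auto

lemma d_le_iff: "0 \<le> x \<Longrightarrow> x < 1 \<Longrightarrow> 0 \<le> y \<Longrightarrow> y < 1 \<Longrightarrow> d x \<le> d y \<longleftrightarrow> x \<le> y"
  using d_less_iff[of y x] by auto

text \<open>Continuity and the blow-up at \<open>1\<close> give surjectivity by the intermediate value theorem.\<close>

lemma d_image: "d ` {0..<1} = {d 0..}"
proof
  show "d ` {0..<1} \<subseteq> {d 0..}" using d_mono[of 0] by auto
  show "{d 0..} \<subseteq> d ` {0..<1}"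
  proof
    fix y assume y: "y \<in> {d 0..}"
    have "\<forall>\<^sub>F x in at_left 1. y \<le> d x \<and> x \<in> {0<..<1}"
      using d_blowup eventually_at_left_real[of 0 1]
      by (auto simp: filterlim_at_top intro: eventually_conj)
    then obtain x where x: "y \<le> d x" "0 < x" "x < 1"
      using eventually_happens trivial_limit_at_left_real by fastforce
    have "\<exists>t\<ge>0. t \<le> x \<and> d t = y"
      using x y by (intro IVT' continuous_on_subset[OF d_cont]) auto
    then show "y \<in> d ` {0..<1}" using x by auto
  qed
qed

end

lemma tendsto_at_right_mono:
  fixes g :: "real \<Rightarrow> ereal"
  assumes "a < b" and mono: "\<And>x y. a < x \<Longrightarrow> x \<le> y \<Longrightarrow> y < b \<Longrightarrow> g x \<le> g y"
  shows "(g \<longlongrightarrow> (INF x\<in>{a<..<b}. g x)) (at_right a)"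
proof (rule order_tendstoI)
  fix c assume "c < (INF x\<in>{a<..<b}. g x)"
  then have gt: "\<And>x. x \<in> {a<..<b} \<Longrightarrow> c < g x"
    by (rule less_INF_D)
  show "\<forall>\<^sub>F x in at_right a. c < g x"
    using eventually_at_right_real[OF \<open>a < b\<close>] by eventually_elim (rule gt)
next
  fix c assume "(INF x\<in>{a<..<b}. g x) < c"
  then obtain x where x: "x \<in> {a<..<b}" "g x < c"
    unfolding INF_less_iff by blast
  then have "a < x" by simp
  show "\<forall>\<^sub>F y in at_right a. g y < c"
    using eventually_at_right_real[OF \<open>a < x\<close>]
  proof eventually_elim
    case (elim y)
    then show ?case using mono[of y x] x by (auto intro: le_less_trans)
  qed
qed

lemma tendsto_at_left_mono:
  fixes g :: "real \<Rightarrow> ereal"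
  assumes "a < b" and mono: "\<And>x y. a < x \<Longrightarrow> x \<le> y \<Longrightarrow> y < b \<Longrightarrow> g x \<le> g y"
  shows "(g \<longlongrightarrow> (SUP x\<in>{a<..<b}. g x)) (at_left b)"
proof (rule order_tendstoI)
  fix c assume "(SUP x\<in>{a<..<b}. g x) < c"
  then have lt: "\<And>x. x \<in> {a<..<b} \<Longrightarrow> g x < c"
    by (rule SUP_lessD)
  show "\<forall>\<^sub>F x in at_left b. g x < c"
    using eventually_at_left_real[OF \<open>a < b\<close>] by eventually_elim (rule lt)
next
  fix c assume "c < (SUP x\<in>{a<..<b}. g x)"
  then obtain x where x: "x \<in> {a<..<b}" "c < g x"
    unfolding less_SUP_iff by blast
  then have "x < b" by simp
  show "\<forall>\<^sub>F y in at_left b. c < g y"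
    using eventually_at_left_real[OF \<open>x < b\<close>]
  proof eventually_elim
    case (elim y)
    then show ?case using mono[of x y] x by (auto intro: less_le_trans)
  qed
qed

text \<open>A function that lies above its tangent lines has a continuous derivative.  A difference quotient
towards a fixed \<open>z\<close> on the left is a lower bound of the derivative and varies continuously with
the base point; taking \<open>z\<close> close to \<open>x\<close> makes it nearly \<open>d x\<close>.  The upper estimate uses
\<open>z\<close> on the right.\<close>

lemma tangent_derivative_isCont:
  fixes f d :: "real \<Rightarrow> real"
  assumes S: "open S" "x \<in> S"
    and deriv: "\<And>x. x \<in> S \<Longrightarrow> (f has_real_derivative d x) (at x)"
    and tangent: "\<And>x y. x \<in> S \<Longrightarrow> y \<in> S \<Longrightarrow> f x + d x * (y - x) \<le> f y"
  shows "isCont d x"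
proof -
  have quot: "((\<lambda>z. (f z - f x) / (z - x)) \<longlongrightarrow> d x) (at x)"
    using deriv[OF S(2)] by (simp add: has_field_derivative_iff)
  have inS: "\<forall>\<^sub>F z in at x. z \<in> S"
    using S by (simp add: eventually_at_topological) blast
  have contf: "isCont f x"
    using deriv[OF S(2)] by (rule DERIV_isCont)
  have quot_y: "((\<lambda>y. (f z - f y) / (z - y)) \<longlongrightarrow> (f z - f x) / (z - x)) (at x)" if "z \<noteq> x" for z
    using contf that unfolding isCont_def by (intro tendsto_intros) auto
  show ?thesis
    unfolding isCont_def
  proof (rule order_tendstoI)
    fix c assume c: "c < d x"
    have "\<forall>\<^sub>F z in at_left x. c < (f z - f x) / (z - x)"
      using order_tendstoD(1)[OF quot c] by (rule filter_leD[OF at_within_le_at])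
    moreover have "\<forall>\<^sub>F z in at_left x. z \<in> S"
      using inS by (rule filter_leD[OF at_within_le_at])
    moreover have "\<forall>\<^sub>F z in at_left x. z < x"
      by (simp add: eventually_at_filter)
    ultimately have "\<forall>\<^sub>F z in at_left x. c < (f z - f x) / (z - x) \<and> z \<in> S \<and> z < x"
      by eventually_elim simp
    then obtain z where z: "c < (f z - f x) / (z - x)" "z \<in> S" "z < x"
      using eventually_happens trivial_limit_at_left_real by blast
    then have zx: "z \<noteq> x" by simp
    have gt: "\<forall>\<^sub>F y in at x. z < y"
      using z(3) by (intro order_tendstoD(1)[OF tendsto_ident_at])
    show "\<forall>\<^sub>F y in at x. c < d y"
      using order_tendstoD(1)[OF quot_y[OF zx] z(1)] gt inS
    proof eventually_elim
      case (elim y)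
      then have "(f z - f y) / (z - y) \<le> d y"
        using tangent[of y z] z by (simp add: field_simps)
      with elim show ?case by linarith
    qed
  next
    fix c assume c: "d x < c"
    have "\<forall>\<^sub>F z in at_right x. (f z - f x) / (z - x) < c"
      using order_tendstoD(2)[OF quot c] by (rule filter_leD[OF at_within_le_at])
    moreover have "\<forall>\<^sub>F z in at_right x. z \<in> S"
      using inS by (rule filter_leD[OF at_within_le_at])
    moreover have "\<forall>\<^sub>F z in at_right x. x < z"
      by (simp add: eventually_at_filter)
    ultimately have "\<forall>\<^sub>F z in at_right x. (f z - f x) / (z - x) < c \<and> z \<in> S \<and> x < z"
      by eventually_elim simp
    then obtain z where z: "(f z - f x) / (z - x) < c" "z \<in> S" "x < z"
      using eventually_happens trivial_limit_at_right_real by blast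
    then have zx: "z \<noteq> x" by simp
    have lt: "\<forall>\<^sub>F y in at x. y < z"
      using z(3) by (intro order_tendstoD(2)[OF tendsto_ident_at])
    show "\<forall>\<^sub>F y in at x. d y < c"
      using order_tendstoD(2)[OF quot_y[OF zx] z(1)] lt inS
    proof eventually_elim
      case (elim y)
      then have "d y \<le> (f z - f y) / (z - y)"
        using tangent[of y z] z by (simp add: field_simps)
      with elim show ?case by linarith
    qed
  qed
qed

lemma mirror_potential_real:
  assumes "mirror_potential \<psi>" "x \<in> eff_dom \<psi>"
  shows "\<psi> x = ereal (real_of_ereal (\<psi> x))"
  using assms by (cases "\<psi> x") (auto simp: mirror_potential_def eff_dom_def)

text \<open>Convexity of the epigraph yields convexity of the real part: on the domain the values are finite,
so the points of the graph itself lie in the epigraph.\<close>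

lemma mirror_potential_convex:
  assumes mp: "mirror_potential \<psi>"
  shows "convex_on (eff_dom \<psi>) (\<lambda>x. real_of_ereal (\<psi> x))"
proof -
  let ?f = "\<lambda>x. real_of_ereal (\<psi> x)"
  note re = mirror_potential_real[OF mp]
  have *: "\<psi> (u * x + v * y) \<le> ereal (u * ?f x + v * ?f y)"
    if "x \<in> eff_dom \<psi>" "y \<in> eff_dom \<psi>" "0 \<le> u" "0 \<le> v" "u + v = 1" for x y u v
  proof -
    have "(x, ?f x) \<in> ext_epigraph \<psi>" "(y, ?f y) \<in> ext_epigraph \<psi>"
      using eq_refl[OF re[OF that(1)]] eq_refl[OF re[OF that(2)]] by (simp_all only: ext_epigraph_def mem_Collect_eq prod.case)
    moreover have "convex (ext_epigraph \<psi>)"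
      using mp by (simp add: mirror_potential_def)
    ultimately have "u *\<^sub>R (x, ?f x) + v *\<^sub>R (y, ?f y) \<in> ext_epigraph \<psi>"
      using that by (intro convexD)
    then show ?thesis
      by (simp add: ext_epigraph_def)
  qed
  have cvx: "convex (eff_dom \<psi>)"
    unfolding convex_def
  proof (intro ballI allI impI)
    fix x y u v :: real
    assume "x \<in> eff_dom \<psi>" "y \<in> eff_dom \<psi>" "0 \<le> u" "0 \<le> v" "u + v = 1"
    from *[OF this] show "u *\<^sub>R x + v *\<^sub>R y \<in> eff_dom \<psi>"
      unfolding eff_dom_def by (auto intro: le_less_trans)
  qed
  show ?thesis
    unfolding convex_on_def
  proof (intro conjI cvx ballI allI impI)
    fix x y u v :: real
    assume A: "x \<in> eff_dom \<psi>" "y \<in> eff_dom \<psi>" "0 \<le> u" "0 \<le> v" "u + v = 1"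
    then have "u *\<^sub>R x + v *\<^sub>R y \<in> eff_dom \<psi>"
      using cvx by (intro convexD)
    from re[OF this] show "?f (u *\<^sub>R x + v *\<^sub>R y) \<le> u * ?f x + v * ?f y"
      using *[OF A] by (metis ereal_less_eq(3) real_scaleR_def)
  qed
qed

text \<open>The boundary conditions of this locale locate the unit interval in the domain: \<open>0\<close> is an interior point
of it (\<open>zero_int\<close>) and \<open>1\<close> is not (\<open>one_not_int\<close>).\<close>

locale mirror_psi =
  fixes \<psi> :: "real \<Rightarrow> ereal"
  assumes potential: "mirror_potential \<psi>"
    and deriv_0_finite: "psi_deriv_0p \<psi> > -\<infinity>"
    and deriv_1_infinite: "psi_deriv_1m \<psi> = \<infinity>"
begin

abbreviation "dom\<^sub>i \<equiv> interior (eff_dom \<psi>)"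
abbreviation "f \<equiv> \<lambda>x. real_of_ereal (\<psi> x)"
abbreviation "d \<equiv> psi_deriv \<psi>"

lemma psi_real: "x \<in> eff_dom \<psi> \<Longrightarrow> \<psi> x = ereal (f x)"
  using mirror_potential_real[OF potential] .

lemma unit_dom: "{0..1} \<subseteq> eff_dom \<psi>"
  using potential by (simp add: mirror_potential_def)

lemma unit_int: "0 < x \<Longrightarrow> x < 1 \<Longrightarrow> x \<in> dom\<^sub>i"
  using interior_mono[OF unit_dom] by auto

lemma psi_DERIV: "x \<in> dom\<^sub>i \<Longrightarrow> (f has_real_derivative d x) (at x)"
proof -
  assume x: "x \<in> dom\<^sub>i"
  have "f differentiable_on dom\<^sub>i"
    using potential by (simp add: mirror_potential_def)
  with x have "f differentiable at x"
    by (simp add: differentiable_on_eq_differentiable_at)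
  then show ?thesis
    unfolding psi_deriv_def by (rule DERIV_deriv_iff_real_differentiable[THEN iffD2])
qed

lemma psi_tangent: "x \<in> dom\<^sub>i \<Longrightarrow> y \<in> eff_dom \<psi> \<Longrightarrow> f x + d x * (y - x) \<le> f y"
  using convex_on_imp_above_tangent[OF mirror_potential_convex[OF potential], of x y "d x"]
    convex_connected[OF convex_on_imp_convex[OF mirror_potential_convex[OF potential]]]
    has_field_derivative_at_within[OF psi_DERIV[of x]] by simp

lemma convex_int: "convex dom\<^sub>i"
  by (intro convex_interior convex_on_imp_convex[OF mirror_potential_convex[OF potential]])

text \<open>Equal slopes at two points would make the function affine between them; the two tangent lines
evaluated at the midpoint contradict strict convexity there.\<close>

lemma d_less:
  assumes xy: "x \<in> dom\<^sub>i" "y \<in> dom\<^sub>i" "x < y"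
  shows "d x < d y"
proof -
  have E: "dom\<^sub>i \<subseteq> eff_dom \<psi>" by (rule interior_subset)
  let ?m = "(x + y) / 2"
  have m: "?m \<in> dom\<^sub>i"
    using convexD[OF convex_int xy(1,2), of "1/2" "1/2"] by (simp add: field_simps)
  have 1: "f x + d x * (?m - x) \<le> f ?m" "f y + d y * (?m - y) \<le> f ?m"
    using psi_tangent xy m E by blast+
  have "\<forall>x\<in>dom\<^sub>i. \<forall>y\<in>dom\<^sub>i. \<forall>t. x \<noteq> y \<and> 0 < t \<and> t < 1 \<longrightarrow>
        \<psi> ((1 - t) * x + t * y) < ereal (1 - t) * \<psi> x + ereal t * \<psi> y"
    using potential unfolding mirror_potential_def by (elim conjE)
  from this[rule_format, of x y "1/2"] xy
  have "\<psi> ((1 - 1/2) * x + 1/2 * y) < ereal (1 - 1/2) * \<psi> x + ereal (1/2) * \<psi> y"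
    by auto
  also have "(1 - 1/2) * x + 1/2 * y = ?m" by (simp add: field_simps)
  finally have "\<psi> ?m < ereal (1 - 1/2) * \<psi> x + ereal (1/2) * \<psi> y" .
  moreover have "\<psi> ?m = ereal (f ?m)" "\<psi> x = ereal (f x)" "\<psi> y = ereal (f y)"
    using psi_real m xy E by blast+
  ultimately have 2: "f ?m < f x / 2 + f y / 2"
    by (cases "\<psi> ?m"; cases "\<psi> x"; cases "\<psi> y") auto
  have "d x * ((y - x) / 2) + d y * ((x - y) / 2) < 0"
    using 1 2 by (simp add: field_simps)
  then have "(d y - d x) * (y - x) > 0" by (simp add: field_simps)
  then show ?thesis using xy by (simp add: zero_less_mult_iff)
qed

lemma d_isCont: "x \<in> dom\<^sub>i \<Longrightarrow> isCont d x"
  by (rule tangent_derivative_isCont[of "dom\<^sub>i" x f])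
     (use psi_DERIV psi_tangent interior_subset in blast)+

lemma d_le_unit: "0 < x \<Longrightarrow> x \<le> y \<Longrightarrow> y < 1 \<Longrightarrow> d x \<le> d y"
  using d_less[of x y] unit_int by (cases "x = y") auto

lemma lim_0: "((\<lambda>x. ereal (d x)) \<longlongrightarrow> psi_deriv_0p \<psi>) (at_right 0)"
  unfolding psi_deriv_0p_def
proof -
  have "((\<lambda>x. ereal (d x)) \<longlongrightarrow> (INF x\<in>{0<..<1}. ereal (d x))) (at_right 0)"
    by (rule tendsto_at_right_mono) (use d_le_unit in auto)
  then show "((\<lambda>x. ereal (d x)) \<longlongrightarrow> Lim (at_right 0) (\<lambda>x. ereal (d x))) (at_right 0)"
    using tendsto_Lim[OF trivial_limit_at_right_real] by metis
qed

lemma lim_1: "((\<lambda>x. ereal (d x)) \<longlongrightarrow> \<infinity>) (at_left 1)"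
  unfolding deriv_1_infinite[symmetric] psi_deriv_1m_def
proof -
  have "((\<lambda>x. ereal (d x)) \<longlongrightarrow> (SUP x\<in>{0<..<1}. ereal (d x))) (at_left 1)"
    by (rule tendsto_at_left_mono) (use d_le_unit in auto)
  then show "((\<lambda>x. ereal (d x)) \<longlongrightarrow> Lim (at_left 1) (\<lambda>x. ereal (d x))) (at_left 1)"
    using tendsto_Lim[OF trivial_limit_at_left_real] by metis
qed

text \<open>At a boundary point of the domain the derivative is unbounded along every sequence of interior
points.  Here it is monotone, hence bounded above near \<open>0\<close>, and its right limit exceeds
\<open>-\<infinity>\<close>, which bounds it below.\<close>

lemma zero_int: "0 \<in> dom\<^sub>i"
proof (rule ccontr)
  assume "0 \<notin> dom\<^sub>i"
  then have fr: "0 \<in> frontier (eff_dom \<psi>)"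
    using subsetD[OF unit_dom, of 0] subsetD[OF closure_subset, of 0 "eff_dom \<psi>"]
    by (simp add: frontier_def)
  \<comment> \<open>The shift by \<open>2\<close> keeps the sequence inside the open unit interval.\<close>
  define X where "X n = 1 / (real n + 2)" for n
  have X: "0 < X n" "X n \<le> 1/2" for n
    by (auto simp: X_def field_simps)
  have Xint: "X n \<in> dom\<^sub>i" for n
    using X[of n] by (intro unit_int) linarith+
  have lim: "X \<longlonglongrightarrow> 0"
    unfolding X_def using LIMSEQ_ignore_initial_segment[OF lim_1_over_n[where 'a = real], of 2]
    by (simp add: add.commute)
  have "\<forall>X x. (\<forall>n. X n \<in> dom\<^sub>i) \<and> X \<longlonglongrightarrow> x \<and> x \<in> frontier (eff_dom \<psi>) \<longrightarrow>
        filterlim (\<lambda>n. \<bar>d (X n)\<bar>) at_top sequentially"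
    using potential unfolding mirror_potential_def by (elim conjE)
  then have inf: "filterlim (\<lambda>n. \<bar>d (X n)\<bar>) at_top sequentially"
    using Xint fr lim by blast
  obtain c where c: "ereal c < psi_deriv_0p \<psi>"
    using deriv_0_finite by (metis ereal_dense2 )
  have "filterlim X (at_right 0) sequentially"
    using lim X by (intro tendsto_imp_filterlim_at_right) auto
  then have "\<forall>\<^sub>F n in sequentially. ereal c < ereal (d (X n))"
    by (intro order_tendstoD(1)[OF filterlim_compose[OF lim_0] c])
  moreover have "\<forall>\<^sub>F n in sequentially. \<bar>d (X n)\<bar> > \<bar>c\<bar> + \<bar>d (1/2)\<bar>"
    using inf by (simp add: filterlim_at_top_dense)
  ultimately have "\<forall>\<^sub>F n in sequentially. False"
  proof eventually_elim
    case (elim n)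
    then show ?case using d_le_unit[of "X n" "1/2"] X[of n] by auto
  qed
  then show False by simp
qed

text \<open>The derivative is continuous in the interior of the domain, so an interior point has a finite
derivative limit.\<close>

lemma one_not_int: "1 \<notin> dom\<^sub>i"
proof
  assume "1 \<in> dom\<^sub>i"
  then have "isCont d 1" by (rule d_isCont)
  then have "((\<lambda>x. ereal (d x)) \<longlongrightarrow> ereal (d 1)) (at_left 1)"
    unfolding isCont_def by - (rule tendsto_ereal, erule tendsto_mono[OF at_within_le_at])
  from tendsto_unique[OF trivial_limit_at_left_real lim_1 this] show False
    by simp
qed

lemma unit_int': "0 \<le> x \<Longrightarrow> x < 1 \<Longrightarrow> x \<in> dom\<^sub>i"
  using unit_int zero_int by (cases "x = 0") auto

lemma deriv_0p: "psi_deriv_0p \<psi> = ereal (d 0)"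
proof -
  have "((\<lambda>x. ereal (d x)) \<longlongrightarrow> ereal (d 0)) (at_right 0)"
    using d_isCont[OF zero_int] unfolding isCont_def
    by - (rule tendsto_ereal, erule tendsto_mono[OF at_within_le_at])
  then show ?thesis
    by (rule tendsto_unique[OF trivial_limit_at_right_real lim_0])
qed

sublocale mirror_derivative f d
proof
  show "f x + d x * (y - x) \<le> f y" if "0 \<le> x" "x < 1" "0 \<le> y" "y \<le> 1" for x y
    using psi_tangent unit_int' unit_dom that by auto
  show "continuous_on {0..<1} d"
    using d_isCont unit_int' by (intro continuous_at_imp_continuous_on) auto
  show "strict_mono_on {0..<1} d"
    using d_less unit_int' by (intro strict_mono_onI) auto
  show "filterlim d at_top (at_left 1)"
    using lim_1 by (simp add: tendsto_PInfty_eq_at_top)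
qed

end

lemma strict_antimono_on_reflect:
  fixes g :: "real \<Rightarrow> real"
  assumes "strict_mono_on {0..<1} g"
  shows "strict_antimono_on {0<..1} (\<lambda>x. g (1 - x))"
proof (rule monotone_onI)
  fix x y :: real assume "x \<in> {0<..1}" "y \<in> {0<..1}" "x < y"
  then show "g (1 - y) < g (1 - x)"
    using strict_mono_onD[OF assms, of "1 - y" "1 - x"] by simp
qed

context mirror_psi begin

lemma chi_continuous: "continuous_on {0<..1} (chi \<psi>)"
  unfolding chi_def[abs_def]
proof (rule continuous_on_compose2[OF d_cont])
  show "continuous_on {0<..1} (\<lambda>x::real. 1 - x)"
    by (intro continuous_on_diff continuous_on_const continuous_on_id)
  show "(\<lambda>x::real. 1 - x) ` {0<..1} \<subseteq> {0..<1}"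
    by auto
qed

lemma chi_strict_antimono: "strict_antimono_on {0<..1} (chi \<psi>)"
  unfolding chi_def[abs_def] by (rule strict_antimono_on_reflect[OF d_strict])

lemma chi_image: "chi \<psi> ` {0<..1} = {d 0..}"
proof -
  have "(\<lambda>x. 1 - x) ` {0<..1} = {0..<1::real}"
    by (rule set_eqI) (simp add: image_iff)
  then have "d ` ((\<lambda>x. 1 - x) ` {0<..1}) = {d 0..}"
    by (simp add: d_image)
  then show ?thesis
    unfolding chi_def[abs_def] by (simp only: image_image)
qed

text \<open>In terms of a probability \<open>x\<close>, the dual variable \<open>d x\<close> encodes the complementary mass
\<open>1 - x\<close>; this is how the inverse of \<open>chi\<close> enters the error bounds.\<close>

lemma chi_inv_d:
  assumes "0 \<le> x" "x < 1"
  shows "chi_inv \<psi> (d x) = 1 - x"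
proof -
  have "inj_on (chi \<psi>) {0<..1}"
    by (rule linorder_inj_onI') (use monotone_onD[OF chi_strict_antimono] in fastforce)
  then show ?thesis
    unfolding chi_inv_def using inv_into_f_f[of "chi \<psi>" "{0<..1}" "1 - x"] assms
    by (simp add: chi_def)
qed

lemma chi_inv_pos:
  assumes "d 0 \<le> y" shows "0 < chi_inv \<psi> y"
  using inv_into_into[of y "chi \<psi>" "{0<..1}"] assms by (simp add: chi_inv_def chi_image)

lemma chi_inv_antimono:
  assumes "d 0 \<le> y" "y \<le> y'" shows "chi_inv \<psi> y' \<le> chi_inv \<psi> y"
proof -
  have "y \<in> d ` {0..<1}" "y' \<in> d ` {0..<1}"
    unfolding d_image using assms by auto
  then obtain x x' where "0 \<le> x" "x < 1" "y = d x" "0 \<le> x'" "x' < 1" "y' = d x'"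
    by auto
  then show ?thesis using assms d_le_iff by (simp add: chi_inv_d)
qed

end

section \<open>Optimality conditions of one mirror descent step\<close>

lemma pmf_of_simplex:
  fixes g :: "'a::finite \<Rightarrow> real"
  assumes "\<And>a. 0 \<le> g a" "(\<Sum>a\<in>UNIV. g a) = 1"
  obtains p where "\<And>a. pmf p a = g a"
proof
  show "pmf (embed_pmf g) a = g a" for a
  proof (rule pmf_embed_pmf)
    show "(\<integral>\<^sup>+ x. ennreal (g x) \<partial>count_space UNIV) = 1"
      using assms by (simp add: nn_integral_count_space_finite sum_ennreal)
  qed (rule assms)
qed

text \<open>Moving mass between two actions changes a separable objective in two terms only.\<close>

lemma sum_swap_two:
  fixes F G :: "'a::finite \<Rightarrow> real"
  assumes "a \<noteq> b" "\<And>x. x \<noteq> a \<Longrightarrow> x \<noteq> b \<Longrightarrow> F x = G x"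
  shows "(\<Sum>x\<in>UNIV. F x) - (\<Sum>x\<in>UNIV. G x) = (F a - G a) + (F b - G b)"
proof -
  have "(\<Sum>x\<in>UNIV. F x) - (\<Sum>x\<in>UNIV. G x) = (\<Sum>x\<in>UNIV. F x - G x)"
    by (simp add: sum_subtractf)
  also have "\<dots> = (\<Sum>x\<in>{a, b}. F x - G x)"
    by (rule sum.mono_neutral_right) (use assms in auto)
  finally show ?thesis using assms(1) by simp
qed

context mirror_derivative
begin

text \<open>A maximiser cannot gain by moving mass \<open>e\<close> from \<open>a\<close> to \<open>b\<close>.  Bounding both
increments of \<open>f\<close> by tangents at the new points gives a bound on the slopes that needs no
derivative at \<open>pmf p a\<close>, so that it also covers the case \<open>pmf p a = 1\<close>.\<close>

lemma transfer_ineq: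
  fixes p :: "'a::finite pmf"
  assumes opt: "\<And>p'. (\<Sum>x\<in>UNIV. c x * pmf p' x - f (pmf p' x)) \<le> (\<Sum>x\<in>UNIV. c x * pmf p x - f (pmf p x))"
    and ab: "a \<noteq> b" and e: "0 < e" "e \<le> pmf p a" "pmf p b + e < 1"
  shows "c b - c a \<le> d (pmf p b + e) - d (pmf p a - e)"
proof -
  let ?g = "(pmf p)(a := pmf p a - e, b := pmf p b + e)"
  have s: "(\<Sum>x\<in>UNIV. pmf p x) = 1"
    by (simp add: sum_pmf_eq_1)
  have "(\<Sum>x\<in>UNIV. ?g x) - (\<Sum>x\<in>UNIV. pmf p x) = 0"
    using ab by (subst sum_swap_two[of a b]) auto
  then have g1: "(\<Sum>x\<in>UNIV. ?g x) = 1" using s by simp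
  have g0: "0 \<le> ?g x" for x using e by auto
  obtain p' where p': "\<And>x. pmf p' x = ?g x"
    using pmf_of_simplex[of ?g] g0 g1 by blast
  have "(\<Sum>x\<in>UNIV. c x * ?g x - f (?g x)) - (\<Sum>x\<in>UNIV. c x * pmf p x - f (pmf p x)) \<le> 0"
    using opt[of p'] unfolding p' by simp
  also have "(\<Sum>x\<in>UNIV. c x * ?g x - f (?g x)) - (\<Sum>x\<in>UNIV. c x * pmf p x - f (pmf p x)) =
      (c b - c a) * e + (f (pmf p a) - f (pmf p a - e)) + (f (pmf p b) - f (pmf p b + e))"
    using ab by (subst sum_swap_two[of a b]) (auto simp: algebra_simps)
  finally have 1: "(c b - c a) * e \<le> (f (pmf p a - e) - f (pmf p a)) + (f (pmf p b + e) - f (pmf p b))"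
    by simp
  have "pmf p a - e < 1" using e pmf_le_1[of p a] by linarith
  then have 2: "f (pmf p a - e) + d (pmf p a - e) * e \<le> f (pmf p a)"
    using tangent[of "pmf p a - e" "pmf p a"] e by (simp add: pmf_le_1)
  have 3: "f (pmf p b + e) - d (pmf p b + e) * e \<le> f (pmf p b)"
    using tangent[of "pmf p b + e" "pmf p b"] e by (simp add: pmf_le_1)
  have "(c b - c a) * e \<le> (d (pmf p b + e) - d (pmf p a - e)) * e"
    using 1 2 3 by (simp add: algebra_simps)
  then show ?thesis using e by simp
qed

text \<open>At a point mass on \<open>a\<close>, shifting a little mass to another action costs at a bounded rate, while
it gains at the rate at which \<open>d\<close> blows up at \<open>1\<close>.\<close>

lemma maximiser_less_1:
  fixes p :: "'a::finite pmf"
  assumes opt: "\<And>p'. (\<Sum>x\<in>UNIV. c x * pmf p' x - f (pmf p' x)) \<le> (\<Sum>x\<in>UNIV. c x * pmf p x - f (pmf p x))"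
    and ab: "a \<noteq> b"
  shows "pmf p a < 1"
proof (rule ccontr)
  assume "\<not> pmf p a < 1"
  then have a: "pmf p a = 1" using pmf_le_1[of p a] by linarith
  have "pmf p a + pmf p b \<le> (\<Sum>x\<in>UNIV. pmf p x)"
    using ab sum_mono2[of UNIV "{a, b}" "pmf p"] by simp
  then have b: "pmf p b = 0"
    using a pmf_nonneg[of p b] by (simp add: sum_pmf_eq_1)
  have "\<forall>\<^sub>F x in at_left 1. d (1/2) + c a - c b + 1 \<le> d x \<and> x \<in> {1/2<..<1}"
    using d_blowup eventually_at_left_real[of "1/2" 1]
    by (auto simp: filterlim_at_top intro: eventually_conj)
  then obtain x where x: "d (1/2) + c a - c b + 1 \<le> d x" "1/2 < x" "x < 1"
    using eventually_happens trivial_limit_at_left_real by fastforce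
  have "c b - c a \<le> d (1 - x) - d x"
    using transfer_ineq[OF opt ab, of "1 - x"] a b x by simp
  moreover have "d (1 - x) \<le> d (1/2)"
    using x by (intro d_mono) auto
  ultimately show False using x by linarith
qed

text \<open>The limit of \<open>transfer_ineq\<close> as the transferred mass vanishes: actions in the support of the
maximiser have the largest partial derivative.\<close>

lemma maximiser_kkt:
  fixes p :: "'a::finite pmf"
  assumes opt: "\<And>p'. (\<Sum>x\<in>UNIV. c x * pmf p' x - f (pmf p' x)) \<le> (\<Sum>x\<in>UNIV. c x * pmf p x - f (pmf p x))"
    and less1: "\<And>x. pmf p x < 1" and a: "0 < pmf p a"
  shows "c b - d (pmf p b) \<le> c a - d (pmf p a)"
proof (cases "a = b")
  case False
  let ?u = "\<lambda>n. pmf p b + inverse (real (Suc n))" and ?v = "\<lambda>n. pmf p a - inverse (real (Suc n))"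
  have i: "(\<lambda>n. inverse (real (Suc n))) \<longlonglongrightarrow> 0"
    by (rule LIMSEQ_inverse_real_of_nat)
  have u: "?u \<longlonglongrightarrow> pmf p b" and v: "?v \<longlonglongrightarrow> pmf p a"
    using tendsto_add[OF tendsto_const i, of "pmf p b"] tendsto_diff[OF tendsto_const i, of "pmf p a"]
    by simp_all
  have ev: "\<forall>\<^sub>F n in sequentially. ?u n < 1" "\<forall>\<^sub>F n in sequentially. 0 < ?v n"
    by (rule order_tendstoD(2)[OF u less1], rule order_tendstoD(1)[OF v a])
  have ru: "\<forall>\<^sub>F n in sequentially. ?u n \<in> {0..<1}"
    using ev(1) by eventually_elim (auto intro: add_nonneg_nonneg)
  have rv: "\<forall>\<^sub>F n in sequentially. ?v n \<in> {0..<1}"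
    using ev(2)
  proof eventually_elim
    case (elim n)
    have "inverse (real (Suc n)) > 0" by simp
    then have "?v n < 1" using less1[of a] by linarith
    with elim show ?case by simp
  qed
  have lu: "(\<lambda>n. d (?u n)) \<longlonglongrightarrow> d (pmf p b)" and lv: "(\<lambda>n. d (?v n)) \<longlonglongrightarrow> d (pmf p a)"
    using continuous_on_tendsto_compose[OF d_cont u _ ru] continuous_on_tendsto_compose[OF d_cont v _ rv] less1
    by auto
  have "c b - c a \<le> d (pmf p b) - d (pmf p a)"
  proof (rule tendsto_lowerbound[OF tendsto_diff[OF lu lv]])
    show "\<forall>\<^sub>F n in sequentially. c b - c a \<le> d (?u n) - d (?v n)"
      using ev
    proof eventually_elim
      case (elim n)
      then show ?case using transfer_ineq[OF opt False, of "inverse (real (Suc n))"] by simp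
    qed
  qed simp
  then show ?thesis by simp
qed simp

end

context mirror_psi begin

text \<open>The gradient is taken of the real part of an extended-valued function; near \<open>q\<close> all
coordinates stay in the interior of the domain, where all values are finite.\<close>

lemma grad_mirror_map:
  fixes q :: "real ^ 'a::finite"
  assumes q: "\<And>a. q $ a \<in> dom\<^sub>i"
  shows "grad (mirror_map \<psi>) q = (\<chi> a. d (q $ a))"
proof -
  let ?D = "(\<chi> a. d (q $ a)) :: real ^ 'a"
  let ?S = "{x :: real ^ 'a. \<forall>a. x $ a \<in> dom\<^sub>i}"
  have S: "open ?S"
  proof -
    have "open (\<Inter>a. (\<lambda>x :: real ^ 'a. x $ a) -` dom\<^sub>i)"
      by (intro open_INT finite ballI open_vimage open_interior continuous_on_component continuous_on_id)
    moreover have "?S = (\<Inter>a. (\<lambda>x. x $ a) -` dom\<^sub>i)" by auto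
    ultimately show ?thesis by simp
  qed
  have "((\<lambda>x. \<Sum>a\<in>UNIV. f (x $ a)) has_derivative (\<lambda>h. \<Sum>a\<in>UNIV. d (q $ a) * h $ a)) (at q)"
  proof (rule has_derivative_sum)
    fix a :: 'a
    have "(f has_derivative (\<lambda>h. d (q $ a) * h)) (at (q $ a))"
      using psi_DERIV[OF q] by (simp add: has_field_derivative_def)
    moreover have "((\<lambda>x. x $ a) has_derivative (\<lambda>h. h $ a)) (at q)"
      by (intro bounded_linear_imp_has_derivative bounded_linear_vec_nth)
    ultimately show "((\<lambda>x. f (x $ a)) has_derivative (\<lambda>h. d (q $ a) * h $ a)) (at q)"
      by (rule has_derivative_compose[rotated])
  qed
  then have "((\<lambda>x. real_of_ereal (mirror_map \<psi> x)) has_derivative (\<lambda>h. \<Sum>a\<in>UNIV. d (q $ a) * h $ a)) (at q)"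
  proof (rule has_derivative_transform_within_open[OF _ S])
    fix x assume x: "x \<in> ?S"
    have "mirror_map \<psi> x = (\<Sum>a\<in>UNIV. ereal (f (x $ a)))"
      unfolding mirror_map_def by (intro sum.cong refl psi_real) (use x interior_subset in auto)
    then show "(\<Sum>a\<in>UNIV. f (x $ a)) = real_of_ereal (mirror_map \<psi> x)"
      by (simp add: sum_ereal)
  qed (use q in simp)
  moreover have "(\<lambda>h. \<Sum>a\<in>UNIV. d (q $ a) * h $ a) = (\<lambda>h. h \<bullet> ?D)"
    by (auto simp: inner_vec_def mult.commute)
  ultimately have G: "GDERIV (\<lambda>x. real_of_ereal (mirror_map \<psi> x)) q :> ?D"
    by (simp add: gderiv_def)
  show ?thesis
    unfolding grad_def
  proof (rule the_equality)
    show "GDERIV (\<lambda>x. real_of_ereal (mirror_map \<psi> x)) q :> ?D" by (rule G)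
  next
    fix D assume "GDERIV (\<lambda>x. real_of_ereal (mirror_map \<psi> x)) q :> D"
    then have "(\<lambda>h. h \<bullet> D) = (\<lambda>h. h \<bullet> ?D)"
      using G unfolding gderiv_def by (rule has_derivative_unique)
    then show "D = ?D"
      using vector_eq_ldot[of D ?D] by metis
  qed
qed

lemma mirror_map_pmf:
  "mirror_map \<psi> (pmf_vec p) = ereal (\<Sum>a\<in>UNIV. f (pmf p a))"
proof -
  have "mirror_map \<psi> (pmf_vec p) = (\<Sum>a\<in>UNIV. ereal (f (pmf p a)))"
    unfolding mirror_map_def pmf_vec_def
    by (intro sum.cong refl) (simp, rule psi_real, use unit_dom in \<open>auto simp: pmf_le_1\<close>)
  then show ?thesis by (simp add: sum_ereal)
qed

text \<open>The Bregman divergence contributes \<open>f\<close>, a linear term and a constant, so that maximising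
the objective means maximising a concave function that is separable over actions.\<close>

lemma pmd_objective_eq:
  fixes P :: "'s::finite \<Rightarrow> 'a::finite \<Rightarrow> 's pmf"
  assumes q: "\<And>a. pmf (\<pi> s) a < 1"
  obtains K where "\<And>p. pmd_objective P r \<gamma> \<psi> \<eta> \<pi> s p =
      ereal ((\<Sum>a\<in>UNIV. (\<eta> * Q_fun P r \<gamma> \<pi> s a + d (pmf (\<pi> s) a)) * pmf p a - f (pmf p a)) + K)"
proof
  let ?q = "pmf (\<pi> s)"
  fix p
  have "\<And>a. pmf_vec (\<pi> s) $ a \<in> dom\<^sub>i"
    using q by (simp add: pmf_vec_def unit_int')
  then have g: "grad (mirror_map \<psi>) (pmf_vec (\<pi> s)) = (\<chi> a. d (?q a))"
    by (subst grad_mirror_map) (auto simp: pmf_vec_def)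
  show "pmd_objective P r \<gamma> \<psi> \<eta> \<pi> s p =
      ereal ((\<Sum>a\<in>UNIV. (\<eta> * Q_fun P r \<gamma> \<pi> s a + d (?q a)) * pmf p a - f (pmf p a)) +
        (\<Sum>a\<in>UNIV. f (?q a) - d (?q a) * ?q a))"
    unfolding pmd_objective_def bregman_def g mirror_map_pmf
    by (simp add: pmf_vec_def inner_vec_def sum.distrib sum_subtractf algebra_simps sum_distrib_left)
qed

text \<open>The multiplier \<open>l\<close> is the common value of the partial derivatives on the support of the new
policy.  In dual coordinates the new policy is the old one shifted by \<open>\<eta> * Q - l\<close> and, where
this falls below the derivative at \<open>0\<close>, cut off.\<close>

lemma pmd_step:
  fixes P :: "'s::finite \<Rightarrow> 'a::finite \<Rightarrow> 's pmf"
  assumes q: "\<And>a. pmf (\<pi> s) a < 1"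
    and opt: "is_arg_max (pmd_objective P r \<gamma> \<psi> \<eta> \<pi> s) (\<lambda>_. True) p"
    and two: "a\<^sub>1 \<noteq> (a\<^sub>2 :: 'a)"
  shows "pmf p a < 1"
    and "\<exists>l. \<forall>b. d (pmf (\<pi> s) b) + \<eta> * Q_fun P r \<gamma> \<pi> s b - l \<le> d (pmf p b) \<and>
          (0 < pmf p b \<longrightarrow> d (pmf p b) = d (pmf (\<pi> s) b) + \<eta> * Q_fun P r \<gamma> \<pi> s b - l)"
proof -
  let ?c = "\<lambda>a. \<eta> * Q_fun P r \<gamma> \<pi> s a + d (pmf (\<pi> s) a)"
  obtain K where K: "\<And>p. pmd_objective P r \<gamma> \<psi> \<eta> \<pi> s p =
      ereal ((\<Sum>a\<in>UNIV. ?c a * pmf p a - f (pmf p a)) + K)"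
    using pmd_objective_eq[of \<pi> s P r \<gamma> \<eta>] q by blast
  have max: "(\<Sum>x\<in>UNIV. ?c x * pmf p' x - f (pmf p' x)) \<le> (\<Sum>x\<in>UNIV. ?c x * pmf p x - f (pmf p x))" for p'
    using opt unfolding is_arg_max_def K by (auto simp: not_less)
  show less1: "pmf p a < 1" for a
  proof -
    obtain b where "a \<noteq> b" using two by metis
    then show ?thesis by (rule maximiser_less_1[OF max])
  qed
  \<comment> \<open>Any action in the support determines the multiplier.\<close>
  obtain a where a: "0 < pmf p a"
    using set_pmf_not_empty[of p] by (auto simp: set_pmf_eq' )
  note kkt = maximiser_kkt[OF max less1]
  show "\<exists>l. \<forall>b. d (pmf (\<pi> s) b) + \<eta> * Q_fun P r \<gamma> \<pi> s b - l \<le> d (pmf p b) \<and>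
          (0 < pmf p b \<longrightarrow> d (pmf p b) = d (pmf (\<pi> s) b) + \<eta> * Q_fun P r \<gamma> \<pi> s b - l)"
  proof (intro exI[of _ "?c a - d (pmf p a)"] allI conjI impI)
    fix b
    show *: "d (pmf (\<pi> s) b) + \<eta> * Q_fun P r \<gamma> \<pi> s b - (?c a - d (pmf p a)) \<le> d (pmf p b)"
      using kkt[OF a, of b] by linarith
    assume "0 < pmf p b"
    then show "d (pmf p b) = d (pmf (\<pi> s) b) + \<eta> * Q_fun P r \<gamma> \<pi> s b - (?c a - d (pmf p a))"
      using * kkt[of b a] by linarith
  qed
qed

end

section \<open>Values in a finite Markov decision process\<close>

text \<open>The form in which contradictions with boundedness are derived below: a sequence bounded below
cannot lose a fixed amount at every late step.\<close>

lemma no_uniform_descent: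
  fixes W :: "nat \<Rightarrow> real"
  assumes c: "0 < c" and low: "\<And>k. K \<le> k \<Longrightarrow> B \<le> W k"
    and desc: "\<And>k. K \<le> k \<Longrightarrow> W (Suc k) \<le> W k - c"
  shows False
proof -
  have W: "W (K + n) \<le> W K - real n * c" for n
  proof (induction n)
    case (Suc n)
    then show ?case using desc[of "K + n"] by (simp add: algebra_simps)
  qed simp
  obtain n where "(W K - B) / c < real n"
    using reals_Archimedean2 by blast
  then have "W K - B < real n * c" using c by (simp add: field_simps)
  then show False using W[of n] low[of "K + n"] by simp
qed

lemma pmf_average_le:
  fixes p :: "'a::finite pmf"
  assumes "\<And>x. u x \<le> (M::real)" shows "(\<Sum>x\<in>UNIV. pmf p x * u x) \<le> M"
proof -
  have "(\<Sum>x\<in>UNIV. pmf p x * u x) \<le> (\<Sum>x\<in>UNIV. pmf p x * M)"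
    using assms by (intro sum_mono mult_left_mono) auto
  also have "\<dots> = M" by (simp add: sum_distrib_right[symmetric] sum_pmf_eq_1)
  finally show ?thesis .
qed

lemma pmf_average_const: "(\<Sum>x\<in>UNIV. pmf p x * c) = (c::real)" for p :: "'a::finite pmf"
  by (simp add: sum_distrib_right[symmetric] sum_pmf_eq_1)

locale finite_mdp =
  fixes P :: "'s::finite \<Rightarrow> 'a::finite \<Rightarrow> 's pmf" and r :: "'s \<Rightarrow> 'a \<Rightarrow> real" and \<gamma> :: real
  assumes reward: "\<And>s a. 0 \<le> r s a \<and> r s a \<le> 1"
    and discount: "0 \<le> \<gamma>" "\<gamma> < 1"
begin

abbreviation "V \<equiv> V_fun P r \<gamma>"
abbreviation "Q \<equiv> Q_fun P r \<gamma>"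
abbreviation "V\<^sub>o \<equiv> V_opt P r \<gamma>"
abbreviation "Q\<^sub>o \<equiv> Q_opt P r \<gamma>"
abbreviation "A\<^sub>o \<equiv> opt_actions P r \<gamma>"

definition next_val :: "('s \<Rightarrow> real) \<Rightarrow> 's \<Rightarrow> 'a \<Rightarrow> real" where
  "next_val u s a = (\<Sum>s'\<in>UNIV. pmf (P s a) s' * u s')"

lemma V_eq: "V \<pi> s = (\<Sum>a\<in>UNIV. pmf (\<pi> s) a * Q \<pi> s a)"
  by (rule V_fun_eq[OF discount])

lemma Q_eq: "Q \<pi> s a = r s a + \<gamma> * next_val (V \<pi>) s a"
  unfolding next_val_def by (rule Q_fun_eq[OF discount])

lemma next_val_mono: "(\<And>s. u s \<le> v s) \<Longrightarrow> next_val u s a \<le> next_val v s a"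
  unfolding next_val_def by (intro sum_mono mult_left_mono) auto

lemma next_val_diff: "next_val (\<lambda>s. u s - v s) s a = next_val u s a - next_val v s a"
  by (simp add: next_val_def sum_subtractf algebra_simps)

lemma next_val_minus: "next_val (\<lambda>s. - u s) s a = - next_val u s a"
  by (simp add: next_val_def sum_negf)

lemma next_val_tendsto:
  "(\<And>s. (\<lambda>k. u k s) \<longlonglongrightarrow> v s) \<Longrightarrow> (\<lambda>k. next_val (u k) s a) \<longlonglongrightarrow> next_val v s a"
  unfolding next_val_def by (intro tendsto_sum tendsto_mult tendsto_const)

text \<open>A discounted maximum principle: evaluate the hypothesis where \<open>u\<close> is largest.  Policy
improvement, optimality of the limit and the upper error bound all rest on it.\<close>

lemma comparison:
  assumes "\<And>s. u s \<le> c + \<gamma> * (\<Sum>a\<in>UNIV. pmf (\<pi> s) a * next_val u s a)"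
  shows "u s \<le> c / (1 - \<gamma>)"
proof -
  define M where "M = Max (range u)"
  have M: "u s \<le> M" for s unfolding M_def by (rule Max_ge) auto
  have "M \<in> range u" unfolding M_def by (rule Max_in) auto
  then obtain s0 where s0: "M = u s0" by auto
  have "(\<Sum>a\<in>UNIV. pmf (\<pi> s0) a * next_val u s0 a) \<le> M"
    unfolding next_val_def by (intro pmf_average_le M)
  then have "\<gamma> * (\<Sum>a\<in>UNIV. pmf (\<pi> s0) a * next_val u s0 a) \<le> \<gamma> * M"
    using discount by (intro mult_left_mono) auto
  then have "M \<le> c + \<gamma> * M"
    using assms[of s0] s0 by linarith
  then have "M \<le> c / (1 - \<gamma>)"
    using discount by (simp add: field_simps)
  then show ?thesis using M[of s] by linarith
qed

lemma V_le_of_supersolution: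
  assumes "\<And>s a. r s a + \<gamma> * next_val u s a \<le> u s"
  shows "V \<pi> s \<le> u s"
proof -
  have "V \<pi> s - u s \<le> 0 / (1 - \<gamma>)"
  proof (rule comparison[where \<pi> = \<pi>])
    fix s
    have "V \<pi> s - u s = (\<Sum>a\<in>UNIV. pmf (\<pi> s) a * (Q \<pi> s a - u s))"
      by (simp add: V_eq[of \<pi> s] right_diff_distrib sum_subtractf pmf_average_const)
    also have "\<dots> \<le> (\<Sum>a\<in>UNIV. pmf (\<pi> s) a * (\<gamma> * next_val (\<lambda>s. V \<pi> s - u s) s a))"
      using assms[of s] by (intro sum_mono mult_left_mono) (auto simp: Q_eq next_val_diff algebra_simps)
    finally show "V \<pi> s - u s \<le> 0 + \<gamma> * (\<Sum>a\<in>UNIV. pmf (\<pi> s) a * next_val (\<lambda>s. V \<pi> s - u s) s a)"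
      by (simp add: sum_distrib_left mult_ac)
  qed
  then show ?thesis by simp
qed

lemma policy_improvement:
  assumes "\<And>s. V \<pi> s \<le> (\<Sum>a\<in>UNIV. pmf (\<pi>' s) a * Q \<pi> s a)"
  shows "V \<pi> s \<le> V \<pi>' s"
proof -
  have "V \<pi> s - V \<pi>' s \<le> 0 / (1 - \<gamma>)"
  proof (rule comparison[where \<pi> = \<pi>'])
    fix s
    have "V \<pi> s - V \<pi>' s \<le> (\<Sum>a\<in>UNIV. pmf (\<pi>' s) a * (Q \<pi> s a - Q \<pi>' s a))"
      using assms[of s] by (simp add: V_eq[of \<pi>' s] right_diff_distrib sum_subtractf)
    also have "\<dots> = (\<Sum>a\<in>UNIV. pmf (\<pi>' s) a * (\<gamma> * next_val (\<lambda>s. V \<pi> s - V \<pi>' s) s a))"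
      by (simp add: Q_eq next_val_diff algebra_simps)
    finally show "V \<pi> s - V \<pi>' s \<le> 0 + \<gamma> * (\<Sum>a\<in>UNIV. pmf (\<pi>' s) a * next_val (\<lambda>s. V \<pi> s - V \<pi>' s) s a)"
      by (simp add: sum_distrib_left mult_ac)
  qed
  then show ?thesis by simp
qed

lemma next_val_const: "next_val (\<lambda>_. c) s a = c"
  by (simp add: next_val_def pmf_average_const)

lemma V_upper: "V \<pi> s \<le> 1 / (1 - \<gamma>)"
proof (rule V_le_of_supersolution)
  fix s a
  have "1 + \<gamma> * (1 / (1 - \<gamma>)) = 1 / (1 - \<gamma>)" using discount by (simp add: field_simps)
  then show "r s a + \<gamma> * next_val (\<lambda>_. 1 / (1 - \<gamma>)) s a \<le> 1 / (1 - \<gamma>)"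
    using reward[of s a] by (simp only: next_val_const) linarith
qed

lemma V_nonneg: "0 \<le> V \<pi> s"
proof -
  have "0 - V \<pi> s \<le> 0 / (1 - \<gamma>)"
  proof (rule comparison[where \<pi> = \<pi>])
    fix s
    have "0 - V \<pi> s = (\<Sum>a\<in>UNIV. pmf (\<pi> s) a * - Q \<pi> s a)"
      by (simp add: V_eq[of \<pi> s] sum_negf)
    also have "\<dots> \<le> (\<Sum>a\<in>UNIV. pmf (\<pi> s) a * (\<gamma> * next_val (\<lambda>s. 0 - V \<pi> s) s a))"
      using reward[of s] by (intro sum_mono mult_left_mono) (auto simp: Q_eq next_val_minus)
    finally show "0 - V \<pi> s \<le> 0 + \<gamma> * (\<Sum>a\<in>UNIV. pmf (\<pi> s) a * next_val (\<lambda>s. 0 - V \<pi> s) s a)"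
      by (simp add: sum_distrib_left mult_ac)
  qed
  then show ?thesis by simp
qed

lemma Q_nonneg: "0 \<le> Q \<pi> s a"
  using reward[of s a] discount next_val_mono[of "\<lambda>_. 0" "V \<pi>" s a] V_nonneg
  by (simp add: Q_eq next_val_const)

lemma Q_mono: "(\<And>s. V \<pi> s \<le> V \<pi>' s) \<Longrightarrow> Q \<pi> s a \<le> Q \<pi>' s a"
  using discount by (simp add: Q_eq mult_left_mono next_val_mono)

lemma V_le_V_opt: "V \<pi> s \<le> V\<^sub>o s"
  unfolding V_opt_def by (rule cSUP_upper) (auto intro: bdd_aboveI2 V_upper)

lemma V_opt_upper: "V\<^sub>o s \<le> 1 / (1 - \<gamma>)"
  unfolding V_opt_def by (rule cSUP_least) (auto intro: V_upper)

lemma Q_le_next_V_opt: "Q \<pi> s a \<le> r s a + \<gamma> * next_val V\<^sub>o s a"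
  using discount by (simp add: Q_eq mult_left_mono next_val_mono V_le_V_opt)

lemma Q_le_Q_opt: "Q \<pi> s a \<le> Q\<^sub>o s a"
  unfolding Q_opt_def by (rule cSUP_upper) (auto intro: bdd_aboveI2 Q_le_next_V_opt)

lemma Q_opt_le: "Q\<^sub>o s a \<le> r s a + \<gamma> * next_val V\<^sub>o s a"
  unfolding Q_opt_def by (rule cSUP_least) (auto intro: Q_le_next_V_opt)

end


section \<open>Convergence of policy mirror descent\<close>

locale pmd_run = finite_mdp P r \<gamma> + mirror_derivative f d
  for P :: "'s::finite \<Rightarrow> 'a::finite \<Rightarrow> 's pmf" and r \<gamma> f d +
  fixes \<eta> :: real and \<pi> :: "nat \<Rightarrow> ('s, 'a) policy"
  assumes step_pos: "0 < \<eta>"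
    and less_1: "\<And>k s a. pmf (\<pi> k s) a < 1"
    and step: "\<And>k s. \<exists>l. \<forall>b. d (pmf (\<pi> k s) b) + \<eta> * Q (\<pi> k) s b - l \<le> d (pmf (\<pi> (Suc k) s) b) \<and>
          (0 < pmf (\<pi> (Suc k) s) b \<longrightarrow>
             d (pmf (\<pi> (Suc k) s) b) = d (pmf (\<pi> k s) b) + \<eta> * Q (\<pi> k) s b - l)"
begin

lemma dual_steps:
  obtains l where
    "\<And>k s b. d (pmf (\<pi> k s) b) + \<eta> * Q (\<pi> k) s b - l k s \<le> d (pmf (\<pi> (Suc k) s) b)"
    "\<And>k s b. 0 < pmf (\<pi> (Suc k) s) b \<Longrightarrow>
       d (pmf (\<pi> (Suc k) s) b) = d (pmf (\<pi> k s) b) + \<eta> * Q (\<pi> k) s b - l k s"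
  using step by metis

text \<open>The first-order optimality of the new policy over the whole simplex: paired with a difference of
two distributions the multiplier cancels.\<close>

lemma variational:
  "\<eta> * (\<Sum>a\<in>UNIV. (pmf u a - pmf (\<pi> (Suc k) s) a) * Q (\<pi> k) s a) \<le>
     (\<Sum>a\<in>UNIV. (pmf u a - pmf (\<pi> (Suc k) s) a) * (d (pmf (\<pi> (Suc k) s) a) - d (pmf (\<pi> k s) a)))"
proof -
  obtain l where
    l: "\<And>k s b. d (pmf (\<pi> k s) b) + \<eta> * Q (\<pi> k) s b - l k s \<le> d (pmf (\<pi> (Suc k) s) b)"
       "\<And>k s b. 0 < pmf (\<pi> (Suc k) s) b \<Longrightarrow>
       d (pmf (\<pi> (Suc k) s) b) = d (pmf (\<pi> k s) b) + \<eta> * Q (\<pi> k) s b - l k s"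
    using dual_steps by blast
  let ?p = "pmf (\<pi> (Suc k) s)" and ?x = "\<lambda>a. d (pmf (\<pi> k s) a) + \<eta> * Q (\<pi> k) s a - d (pmf (\<pi> (Suc k) s) a)"
  have "(\<Sum>a\<in>UNIV. (pmf u a - ?p a) * ?x a) \<le> (\<Sum>a\<in>UNIV. (pmf u a - ?p a) * l k s)"
  proof (rule sum_mono)
    fix a
    show "(pmf u a - ?p a) * ?x a \<le> (pmf u a - ?p a) * l k s"
    proof (cases "0 < ?p a")
      case True
      then show ?thesis using l(2)[OF True] by simp
    next
      case False
      then have "?p a = 0" by (simp add: pmf_nonneg less_eq_real_def not_less)
      then show ?thesis using l(1)[of k s a] by (intro mult_left_mono) auto
    qed
  qed
  also have "\<dots> = 0"
    by (simp add: left_diff_distrib sum_subtractf pmf_average_const)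
  finally show ?thesis
    by (simp add: sum_distrib_left sum_subtractf sum.distrib algebra_simps)
qed

text \<open>Comparing the new policy with the old one in \<open>variational\<close>: the right-hand side is nonpositive
because \<open>d\<close> is increasing.\<close>

lemma improvement: "V (\<pi> k) s \<le> (\<Sum>a\<in>UNIV. pmf (\<pi> (Suc k) s) a * Q (\<pi> k) s a)"
proof -
  let ?p = "pmf (\<pi> (Suc k) s)" and ?q = "pmf (\<pi> k s)"
  have "(?q a - ?p a) * (d (?p a) - d (?q a)) \<le> 0" for a
    using d_le_iff[of "?p a" "?q a"] d_le_iff[of "?q a" "?p a"] less_1
    by (auto simp: mult_le_0_iff linear)
  then have "\<eta> * (\<Sum>a\<in>UNIV. (?q a - ?p a) * Q (\<pi> k) s a) \<le> 0"
    by (intro order_trans[OF variational] sum_nonpos) auto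
  then have "(\<Sum>a\<in>UNIV. (?q a - ?p a) * Q (\<pi> k) s a) \<le> 0"
    using step_pos by (simp add: mult_le_0_iff)
  then show ?thesis
    by (simp add: V_eq left_diff_distrib sum_subtractf)
qed

lemma V_mono: "V (\<pi> k) s \<le> V (\<pi> (Suc k)) s"
  by (rule policy_improvement) (rule improvement)

text \<open>The sequence \<open>W\<close> is the Bregman divergence from the current policy to the point mass at \<open>b\<close>.
By the three-point identity its decrease controls the advantage of playing \<open>b\<close>; this advantage is
measured against the next value, which dominates the average of the current action values under
the new policy.\<close>

lemma three_point:
  "\<exists>W. (\<forall>k. 0 \<le> W k) \<and>
     (\<forall>k. \<eta> * (Q (\<pi> k) s b - V (\<pi> (Suc k)) s) \<le> W k - W (Suc k))"
proof -
  let ?u = "\<lambda>a. pmf (return_pmf b) a"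
  \<comment> \<open>the Bregman divergence of the point mass at \<open>b\<close> from the policy at step \<open>k\<close>\<close>
  define W where "W k = (\<Sum>a\<in>UNIV. f (?u a) - f (pmf (\<pi> k s) a) -
     d (pmf (\<pi> k s) a) * (?u a - pmf (\<pi> k s) a))" for k
  have nn: "0 \<le> f x - f y - d y * (x - y)" if "0 \<le> x" "x \<le> 1" "0 \<le> y" "y < 1" for x y
    using tangent[of y x] that by simp
  have "0 \<le> W k" for k
    unfolding W_def by (intro sum_nonneg nn less_1 pmf_nonneg pmf_le_1)
  moreover have "\<eta> * (Q (\<pi> k) s b - V (\<pi> (Suc k)) s) \<le> W k - W (Suc k)" for k
  proof -
    let ?p = "pmf (\<pi> (Suc k) s)" and ?q = "pmf (\<pi> k s)"
    have "(\<Sum>a\<in>UNIV. ?p a * Q (\<pi> k) s a) \<le> V (\<pi> (Suc k)) s"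
      unfolding V_eq[of "\<pi> (Suc k)"] by (intro sum_mono mult_left_mono Q_mono V_mono pmf_nonneg)
    moreover have "(\<Sum>a\<in>UNIV. ?u a * Q (\<pi> k) s a) = Q (\<pi> k) s b"
      by (simp add: indicator_def if_distrib[of "\<lambda>x. x * _"] cong: if_cong)
    ultimately have "Q (\<pi> k) s b - V (\<pi> (Suc k)) s \<le> (\<Sum>a\<in>UNIV. (?u a - ?p a) * Q (\<pi> k) s a)"
      by (simp add: left_diff_distrib sum_subtractf)
    then have "\<eta> * (Q (\<pi> k) s b - V (\<pi> (Suc k)) s) \<le> \<eta> * (\<Sum>a\<in>UNIV. (?u a - ?p a) * Q (\<pi> k) s a)"
      using step_pos by simp
    also have "\<dots> \<le> (\<Sum>a\<in>UNIV. (?u a - ?p a) * (d (?p a) - d (?q a)))"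
      by (rule variational)
    also have "\<dots> \<le> (\<Sum>a\<in>UNIV. (?u a - ?p a) * (d (?p a) - d (?q a)) +
                      (f (?p a) - f (?q a) - d (?q a) * (?p a - ?q a)))"
      by (intro sum_mono) (use nn[OF pmf_nonneg pmf_le_1 pmf_nonneg less_1] in auto)
    also have "\<dots> = W k - W (Suc k)"
      unfolding W_def sum_subtractf[symmetric] by (intro sum.cong refl) (simp add: algebra_simps)
    finally show ?thesis .
  qed
  ultimately show ?thesis by blast
qed

lemma values_converge: "\<exists>v. \<forall>s. (\<lambda>k. V (\<pi> k) s) \<longlonglongrightarrow> v s"
proof -
  have "\<exists>L. (\<lambda>k. V (\<pi> k) s) \<longlonglongrightarrow> L" for s
    using incseq_convergent[of "\<lambda>k. V (\<pi> k) s" "1 / (1 - \<gamma>)"] V_mono V_upper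
    by (metis incseq_SucI)
  then show ?thesis by metis
qed

text \<open>Otherwise the divergence in \<open>three_point\<close> would decrease by a fixed amount at every late step.\<close>

lemma limit_supersolution:
  assumes v: "\<And>s. (\<lambda>k. V (\<pi> k) s) \<longlonglongrightarrow> v s"
  shows "r s b + \<gamma> * next_val v s b \<le> v s"
proof (rule ccontr)
  let ?L = "r s b + \<gamma> * next_val v s b - v s"
  assume "\<not> ?thesis"
  then have pos: "0 < ?L" by simp
  have "(\<lambda>k. Q (\<pi> k) s b - V (\<pi> (Suc k)) s) \<longlonglongrightarrow> ?L"
    unfolding Q_eq by (intro tendsto_intros next_val_tendsto v LIMSEQ_Suc[OF v])
  then have "\<forall>\<^sub>F k in sequentially. ?L / 2 < Q (\<pi> k) s b - V (\<pi> (Suc k)) s"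
    by (rule order_tendstoD) (use pos in simp)
  then obtain K where K: "\<And>k. K \<le> k \<Longrightarrow> ?L / 2 < Q (\<pi> k) s b - V (\<pi> (Suc k)) s"
    unfolding eventually_sequentially by blast
  obtain W where W: "\<And>k. 0 \<le> W k"
      "\<And>k. \<eta> * (Q (\<pi> k) s b - V (\<pi> (Suc k)) s) \<le> W k - W (Suc k)"
    using three_point[of s b] by blast
  show False
  proof (rule no_uniform_descent[of "\<eta> * (?L / 2)" K 0 W])
    show "0 < \<eta> * (?L / 2)" using pos step_pos by simp
    show "W (Suc k) \<le> W k - \<eta> * (?L / 2)" if "K \<le> k" for k
      using mult_strict_left_mono[OF K[OF that] step_pos] W(2)[of k] by linarith
  qed (use W in auto)
qed

text \<open>The limit of the values is at most the optimal value, as a limit of values of policies, and at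
least the optimal value, as a solution of the Bellman inequality.\<close>

lemma V_tendsto: "(\<lambda>k. V (\<pi> k) s) \<longlonglongrightarrow> V\<^sub>o s"
proof -
  obtain v where v: "\<And>s. (\<lambda>k. V (\<pi> k) s) \<longlonglongrightarrow> v s"
    using values_converge by blast
  have "v s \<le> V\<^sub>o s"
    by (rule tendsto_upperbound[OF v]) (simp_all add: V_le_V_opt)
  moreover have "V\<^sub>o s \<le> v s"
    unfolding V_opt_def
    by (rule cSUP_least) (auto intro: V_le_of_supersolution limit_supersolution v)
  ultimately show ?thesis using v[of s] by simp
qed

lemma Q_tendsto': "(\<lambda>k. Q (\<pi> k) s a) \<longlonglongrightarrow> r s a + \<gamma> * next_val V\<^sub>o s a"
  unfolding Q_eq by (intro tendsto_intros next_val_tendsto V_tendsto)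

lemma Q_opt_eq: "Q\<^sub>o s a = r s a + \<gamma> * next_val V\<^sub>o s a"
proof (rule antisym[OF Q_opt_le])
  show "r s a + \<gamma> * next_val V\<^sub>o s a \<le> Q\<^sub>o s a"
    by (rule tendsto_upperbound[OF Q_tendsto']) (simp_all add: Q_le_Q_opt)
qed

lemma Q_tendsto: "(\<lambda>k. Q (\<pi> k) s a) \<longlonglongrightarrow> Q\<^sub>o s a"
  unfolding Q_opt_eq by (rule Q_tendsto')

lemma Q_opt_le_V_opt: "Q\<^sub>o s a \<le> V\<^sub>o s"
  unfolding Q_opt_eq by (rule limit_supersolution[OF V_tendsto])

text \<open>The values of the iterates are averages of action values and hence stay below the largest
optimal action value; so does their limit.\<close>

lemma opt_actions_nonempty: "A\<^sub>o s \<noteq> {}"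
proof -
  define M where "M = Max (range (Q\<^sub>o s))"
  have M: "Q\<^sub>o s a \<le> M" for a unfolding M_def by (rule Max_ge) auto
  have "M \<in> range (Q\<^sub>o s)" unfolding M_def by (rule Max_in) auto
  then obtain a where a: "M = Q\<^sub>o s a" by auto
  have "V (\<pi> k) s \<le> M" for k
    unfolding V_eq by (rule pmf_average_le) (rule order_trans[OF Q_le_Q_opt M])
  then have "V\<^sub>o s \<le> M"
    by (intro tendsto_upperbound[OF V_tendsto]) auto
  then have "Q\<^sub>o s a = V\<^sub>o s"
    using a Q_opt_le_V_opt[of s a] by simp
  then show ?thesis by (auto simp: opt_actions_def)
qed

text \<open>The performance difference identity: the error of a policy is its expected one-step loss plus
the discounted error at the next state.\<close>

lemma value_gap_eq:
  "V\<^sub>o s - V \<rho> s = (\<Sum>a\<in>UNIV. pmf (\<rho> s) a * (V\<^sub>o s - Q\<^sub>o s a)) +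
     \<gamma> * (\<Sum>a\<in>UNIV. pmf (\<rho> s) a * next_val (\<lambda>s. V\<^sub>o s - V \<rho> s) s a)"
proof -
  have "V\<^sub>o s - V \<rho> s = (\<Sum>a\<in>UNIV. pmf (\<rho> s) a * (V\<^sub>o s - Q \<rho> s a))"
    by (simp add: V_eq[of \<rho>] right_diff_distrib sum_subtractf pmf_average_const)
  also have "\<dots> = (\<Sum>a\<in>UNIV. pmf (\<rho> s) a * (V\<^sub>o s - Q\<^sub>o s a) +
      \<gamma> * (pmf (\<rho> s) a * next_val (\<lambda>s. V\<^sub>o s - V \<rho> s) s a))"
    by (intro sum.cong refl) (simp add: Q_opt_eq Q_eq next_val_diff algebra_simps)
  finally show ?thesis by (simp add: sum.distrib sum_distrib_left)
qed

abbreviation "subopt_mass \<rho> s \<equiv> (\<Sum>a\<in>- A\<^sub>o s. pmf (\<rho> s) a)"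

lemma opt_weighted_sum:
  "(\<Sum>a\<in>UNIV. pmf (\<rho> s) a * (V\<^sub>o s - Q\<^sub>o s a)) = (\<Sum>a\<in>- A\<^sub>o s. pmf (\<rho> s) a * (V\<^sub>o s - Q\<^sub>o s a))"
  by (rule sum.mono_neutral_right) (auto simp: opt_actions_def)

text \<open>One factor \<open>1 / (1 - \<gamma>)\<close> bounds the loss of a single suboptimal action, the other sums the
losses over time.\<close>

lemma value_gap_upper:
  assumes "\<And>s. subopt_mass \<rho> s \<le> e"
  shows "V\<^sub>o s - V \<rho> s \<le> e / (1 - \<gamma>)\<^sup>2"
proof -
  have "V\<^sub>o s - V \<rho> s \<le> (e / (1 - \<gamma>)) / (1 - \<gamma>)"
  proof (rule comparison[where \<pi> = \<rho>])
    fix s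
    have b: "V\<^sub>o s - Q\<^sub>o s a \<le> 1 / (1 - \<gamma>)" for a
      using V_opt_upper[of s] order_trans[OF Q_nonneg Q_le_Q_opt, of s a] by linarith
    have "(\<Sum>a\<in>UNIV. pmf (\<rho> s) a * (V\<^sub>o s - Q\<^sub>o s a)) \<le> (\<Sum>a\<in>- A\<^sub>o s. pmf (\<rho> s) a * (1 / (1 - \<gamma>)))"
      unfolding opt_weighted_sum by (intro sum_mono mult_left_mono b pmf_nonneg)
    also have "\<dots> \<le> e * (1 / (1 - \<gamma>))"
      unfolding sum_distrib_right[symmetric] using assms discount by (intro mult_right_mono) auto
    finally show "V\<^sub>o s - V \<rho> s \<le> e / (1 - \<gamma>) +
        \<gamma> * (\<Sum>a\<in>UNIV. pmf (\<rho> s) a * next_val (\<lambda>s. V\<^sub>o s - V \<rho> s) s a)"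
      using value_gap_eq[of s \<rho>] by simp
  qed
  then show ?thesis by (simp add: power2_eq_square)
qed

text \<open>In \<open>value_gap_eq\<close> the error at the next state is nonnegative, so the loss of the first step
remains as a lower bound.\<close>

lemma value_gap_lower:
  "(\<Sum>a\<in>- A\<^sub>o s. pmf (\<rho> s) a * (V\<^sub>o s - Q\<^sub>o s a)) \<le> V\<^sub>o s - V \<rho> s"
proof -
  have "0 \<le> next_val (\<lambda>s. V\<^sub>o s - V \<rho> s) s a" for a
    unfolding next_val_def by (intro sum_nonneg mult_nonneg_nonneg) (auto simp: V_le_V_opt)
  then have "0 \<le> \<gamma> * (\<Sum>a\<in>UNIV. pmf (\<rho> s) a * next_val (\<lambda>s. V\<^sub>o s - V \<rho> s) s a)"
    using discount by (intro mult_nonneg_nonneg sum_nonneg) auto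
  then show ?thesis using value_gap_eq[of s \<rho>] unfolding opt_weighted_sum by linarith
qed

end

section \<open>The exact rate\<close>

lemma linear_growth:
  fixes z :: "nat \<Rightarrow> real"
  shows "(\<And>k. K \<le> k \<Longrightarrow> z k + c \<le> z (Suc k)) \<Longrightarrow> K \<le> k \<Longrightarrow> z K + (real k - real K) * c \<le> z k"
    and "(\<And>k. K \<le> k \<Longrightarrow> z (Suc k) \<le> z k + c) \<Longrightarrow> K \<le> k \<Longrightarrow> z k \<le> z K + (real k - real K) * c"
proof -
  have 1: "x K + (real k - real K) * e \<le> x k"
    if "K \<le> k" "\<And>k. K \<le> k \<Longrightarrow> x k + e \<le> x (Suc k)" for x :: "nat \<Rightarrow> real" and e
    using that(1)
  proof (induction rule: dec_induct)
    case (step n)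
    then show ?case using that(2)[of n] by (simp add: algebra_simps)
  qed simp
  show "(\<And>k. K \<le> k \<Longrightarrow> z k + c \<le> z (Suc k)) \<Longrightarrow> K \<le> k \<Longrightarrow> z K + (real k - real K) * c \<le> z k"
    by (rule 1)
  show "z k \<le> z K + (real k - real K) * c" if "\<And>k. K \<le> k \<Longrightarrow> z (Suc k) \<le> z k + c" "K \<le> k"
  proof -
    have "- z K + (real k - real K) * - c \<le> - z k"
      by (rule 1[OF that(2)]) (use that(1) in fastforce)
    then show ?thesis by simp
  qed
qed

context finite_mdp begin

lemma state_gap_le: "a \<notin> A\<^sub>o s \<Longrightarrow> state_gap P r \<gamma> s \<le> V\<^sub>o s - Q\<^sub>o s a"
  unfolding state_gap_def by (simp add: Max_ge)

lemma state_gap_attained: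
  assumes "A\<^sub>o s \<noteq> UNIV"
  obtains a where "a \<notin> A\<^sub>o s" "V\<^sub>o s - Q\<^sub>o s a = state_gap P r \<gamma> s"
proof -
  have "Max (Q\<^sub>o s ` (- A\<^sub>o s)) \<in> Q\<^sub>o s ` (- A\<^sub>o s)"
    using assms by (intro Max_in) auto
  then obtain a where "a \<in> - A\<^sub>o s" "Max (Q\<^sub>o s ` (- A\<^sub>o s)) = Q\<^sub>o s a" by (rule imageE)
  then show thesis by (intro that[of a]) (auto simp: state_gap_def)
qed

text \<open>With one action there is nothing to choose, so a state at which some action is suboptimal forces
two distinct actions, as \<open>pmd_step\<close> requires.\<close>

lemma single_action_opt:
  assumes "\<And>a a' :: 'a. a = a'" shows "A\<^sub>o s = UNIV"
proof -
  have "Q \<pi> s b = V \<pi> s" for \<pi> :: "('s, 'a) policy" and b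
  proof -
    have "V \<pi> s = (\<Sum>a\<in>UNIV. pmf (\<pi> s) a * Q \<pi> s b)"
      unfolding V_eq[of \<pi> s] using assms by (intro sum.cong refl) metis
    then show ?thesis by (simp add: pmf_average_const)
  qed
  then show ?thesis by (auto simp: opt_actions_def Q_opt_def V_opt_def)
qed

end

context pmd_run begin

lemma d_prob_ge: "d 0 \<le> d (pmf (\<pi> k s) a)"
  by (rule d_mono) (auto simp: less_1)

lemma subopt_gap_pos: "a \<notin> A\<^sub>o s \<Longrightarrow> 0 < V\<^sub>o s - Q\<^sub>o s a"
  using Q_opt_le_V_opt[of s a] by (auto simp: opt_actions_def)

lemma subopt_tendsto:
  assumes a: "a \<notin> A\<^sub>o s"
  shows "(\<lambda>k. pmf (\<pi> k s) a) \<longlonglongrightarrow> 0"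
proof (rule tendsto_sandwich[of "\<lambda>_. 0" _ _ "\<lambda>k. (V\<^sub>o s - V (\<pi> k) s) / (V\<^sub>o s - Q\<^sub>o s a)"])
  have "pmf (\<pi> k s) a * (V\<^sub>o s - Q\<^sub>o s a) \<le> V\<^sub>o s - V (\<pi> k) s" for k
    by (rule order_trans[OF member_le_sum value_gap_lower])
       (use a Q_opt_le_V_opt in auto)
  then show "\<forall>\<^sub>F k in sequentially. pmf (\<pi> k s) a \<le> (V\<^sub>o s - V (\<pi> k) s) / (V\<^sub>o s - Q\<^sub>o s a)"
    using subopt_gap_pos[OF a] by (simp add: pos_le_divide_eq)
  have "(\<lambda>k. (V\<^sub>o s - V (\<pi> k) s) / (V\<^sub>o s - Q\<^sub>o s a)) \<longlonglongrightarrow> (V\<^sub>o s - V\<^sub>o s) / (V\<^sub>o s - Q\<^sub>o s a)"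
    by (intro tendsto_intros V_tendsto) (use subopt_gap_pos[OF a] in auto)
  then show "(\<lambda>k. (V\<^sub>o s - V (\<pi> k) s) / (V\<^sub>o s - Q\<^sub>o s a)) \<longlonglongrightarrow> 0" by simp
qed auto

lemma subopt_dual_tendsto:
  assumes a: "a \<notin> A\<^sub>o s"
  shows "(\<lambda>k. d (pmf (\<pi> k s) a)) \<longlonglongrightarrow> d 0"
  by (rule continuous_on_tendsto_compose[OF d_cont subopt_tendsto[OF a]]) (auto simp: less_1)

lemma subopt_mass_tendsto: "(\<lambda>k. subopt_mass (\<pi> k) s) \<longlonglongrightarrow> 0"
  using tendsto_sum[of "- A\<^sub>o s" "\<lambda>a k. pmf (\<pi> k s) a" "\<lambda>_. 0"] subopt_tendsto by auto

lemma opt_mass: "(\<Sum>a\<in>A\<^sub>o s. pmf (\<rho> s) a) = 1 - subopt_mass \<rho> s"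
proof -
  have "(\<Sum>a\<in>A\<^sub>o s \<union> - A\<^sub>o s. pmf (\<rho> s) a) = (\<Sum>a\<in>A\<^sub>o s. pmf (\<rho> s) a) + subopt_mass \<rho> s"
    by (rule sum.union_disjoint) auto
  then show ?thesis by (simp add: sum_pmf_eq_1)
qed

text \<open>Starting from a probability of at most one half leaves room up to \<open>3/4\<close>, and \<open>d\<close> is
uniformly continuous on \<open>[0, 3/4]\<close>; this converts dual increments into probability
increments.\<close>

lemma half_modulus:
  assumes "0 < e"
  obtains c where "0 < c" "c \<le> 1/4"
    "\<And>x y. 0 \<le> x \<Longrightarrow> x \<le> 1/2 \<Longrightarrow> x \<le> y \<Longrightarrow> d x + e \<le> d y \<Longrightarrow> x + c \<le> y"
proof -
  have "uniformly_continuous_on {0..3/4} d"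
    by (rule compact_uniformly_continuous[OF continuous_on_subset[OF d_cont]]) auto
  then obtain c where c: "0 < c"
      "\<And>x y. x \<in> {0..3/4} \<Longrightarrow> y \<in> {0..3/4} \<Longrightarrow> dist y x < c \<Longrightarrow> dist (d y) (d x) < e"
    using assms unfolding uniformly_continuous_on_def by metis
  show thesis
  proof (rule that[of "min c (1/4)"])
    fix x y :: real
    assume xy: "0 \<le> x" "x \<le> 1/2" "x \<le> y" "d x + e \<le> d y"
    show "x + min c (1/4) \<le> y"
    proof (rule ccontr)
      assume "\<not> ?thesis"
      then have "y < x + c" "y < x + 1/4" by auto
      then show False using c(2)[of x y] xy by (simp add: dist_real_def)
    qed
  qed (use c in auto)
qed

text \<open>Two optimal actions cannot both have probability above one half.  If the multiplier \<open>l\<close> were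
smaller than \<open>\<eta> * (V\<^sub>o s - g / 2)\<close>, where \<open>g\<close> is the gap of \<open>a\<close>, all optimal actions would gain
probability, and one of probability at most one half would gain at least \<open>c\<close>; but late in the iteration
less than \<open>c\<close> is left to gain.  So the dual variable of \<open>a\<close> loses at least \<open>\<eta> * g / 2\<close> at
every step at which \<open>a\<close> keeps positive probability, until it hits \<open>d 0\<close>, where it remains.\<close>

lemma subopt_eliminated:
  assumes b: "b\<^sub>1 \<in> A\<^sub>o s" "b\<^sub>2 \<in> A\<^sub>o s" "b\<^sub>1 \<noteq> b\<^sub>2" and a: "a \<notin> A\<^sub>o s"
  shows "\<forall>\<^sub>F k in sequentially. pmf (\<pi> k s) a = 0"
proof -
  define g where "g = V\<^sub>o s - Q\<^sub>o s a"
  have g: "0 < g" using subopt_gap_pos[OF a] by (simp add: g_def)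
  have Qb: "Q\<^sub>o s b = V\<^sub>o s" if "b \<in> A\<^sub>o s" for b
    using that by (simp add: opt_actions_def)
  obtain l where
    l: "\<And>k s b. d (pmf (\<pi> k s) b) + \<eta> * Q (\<pi> k) s b - l k s \<le> d (pmf (\<pi> (Suc k) s) b)"
       "\<And>k s b. 0 < pmf (\<pi> (Suc k) s) b \<Longrightarrow>
       d (pmf (\<pi> (Suc k) s) b) = d (pmf (\<pi> k s) b) + \<eta> * Q (\<pi> k) s b - l k s"
    using dual_steps by blast
  obtain c where c: "0 < c" "c \<le> 1/4"
    "\<And>x y. 0 \<le> x \<Longrightarrow> x \<le> 1/2 \<Longrightarrow> x \<le> y \<Longrightarrow> d x + \<eta> * (g / 4) \<le> d y \<Longrightarrow> x + c \<le> y"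
    using half_modulus[of "\<eta> * (g / 4)"] g step_pos by auto
  have "\<forall>b\<in>A\<^sub>o s. \<forall>\<^sub>F k in sequentially. V\<^sub>o s - g / 4 < Q (\<pi> k) s b"
    using order_tendstoD(1)[OF Q_tendsto] Qb g by auto
  then have "\<forall>\<^sub>F k in sequentially. \<forall>b\<in>A\<^sub>o s. V\<^sub>o s - g / 4 < Q (\<pi> k) s b"
    by (rule eventually_ball_finite[rotated]) simp
  moreover have "\<forall>\<^sub>F k in sequentially. subopt_mass (\<pi> k) s < c"
    using order_tendstoD(2)[OF subopt_mass_tendsto c(1)] .
  ultimately have "\<forall>\<^sub>F k in sequentially. (\<forall>b\<in>A\<^sub>o s. V\<^sub>o s - g / 4 < Q (\<pi> k) s b) \<and> subopt_mass (\<pi> k) s < c"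
    by eventually_elim simp
  then obtain K where K: "\<And>k b. K \<le> k \<Longrightarrow> b \<in> A\<^sub>o s \<Longrightarrow> V\<^sub>o s - g / 4 < Q (\<pi> k) s b"
      "\<And>k. K \<le> k \<Longrightarrow> subopt_mass (\<pi> k) s < c"
    unfolding eventually_sequentially by blast
  \<comment> \<open>From here on the optimal actions can gain less than \<open>c\<close> in total.\<close>
  have low: "\<eta> * (V\<^sub>o s - g / 2) \<le> l k s" if k: "K \<le> k" for k
  proof (rule ccontr)
    assume "\<not> ?thesis"
    then have small: "l k s < \<eta> * (V\<^sub>o s - g / 2)" by simp
    have up: "d (pmf (\<pi> k s) b) + \<eta> * (g / 4) \<le> d (pmf (\<pi> (Suc k) s) b)" if "b \<in> A\<^sub>o s" for b
    proof -
      have "\<eta> * (V\<^sub>o s - g / 4) \<le> \<eta> * Q (\<pi> k) s b"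
        using K(1)[OF k that] step_pos by simp
      then show ?thesis using l(1)[of k s b] small by (simp add: algebra_simps)
    qed
    have mono: "pmf (\<pi> k s) b \<le> pmf (\<pi> (Suc k) s) b" if "b \<in> A\<^sub>o s" for b
    proof -
      have "0 < \<eta> * (g / 4)" using step_pos g by simp
      then have "d (pmf (\<pi> k s) b) \<le> d (pmf (\<pi> (Suc k) s) b)"
        using up[OF that] by linarith
      then show ?thesis by (simp add: d_le_iff less_1)
    qed
    obtain b where b: "b \<in> A\<^sub>o s" "pmf (\<pi> k s) b \<le> 1/2"
    proof -
      have "pmf (\<pi> k s) b\<^sub>1 + pmf (\<pi> k s) b\<^sub>2 \<le> 1"
        using b sum_mono2[of UNIV "{b\<^sub>1, b\<^sub>2}" "pmf (\<pi> k s)"] by (simp add: sum_pmf_eq_1)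
      then have "pmf (\<pi> k s) b\<^sub>1 \<le> 1/2 \<or> pmf (\<pi> k s) b\<^sub>2 \<le> 1/2" by linarith
      then show thesis using that b by blast
    qed
    have inc: "pmf (\<pi> k s) b + c \<le> pmf (\<pi> (Suc k) s) b"
      using c(3)[OF _ b(2) mono[OF b(1)] up[OF b(1)]] by simp
    have "c \<le> (\<Sum>a\<in>{b}. pmf (\<pi> (Suc k) s) a - pmf (\<pi> k s) a)"
      using inc by simp
    also have "\<dots> \<le> (\<Sum>a\<in>A\<^sub>o s. pmf (\<pi> (Suc k) s) a - pmf (\<pi> k s) a)"
      using b mono by (intro sum_mono2) auto
    also have "\<dots> = subopt_mass (\<pi> k) s - subopt_mass (\<pi> (Suc k)) s"
      by (simp add: sum_subtractf opt_mass)
    also have "\<dots> < c"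
    proof -
      have "0 \<le> subopt_mass (\<pi> (Suc k)) s" by (intro sum_nonneg) auto
      then show ?thesis using K(2)[OF k] by linarith
    qed
    finally show False by simp
  qed
  have desc: "d (pmf (\<pi> (Suc k) s) a) \<le> d (pmf (\<pi> k s) a) - \<eta> * (g / 2)"
    if k: "K \<le> k" and pos: "0 < pmf (\<pi> (Suc k) s) a" for k
  proof -
    have "\<eta> * Q (\<pi> k) s a \<le> \<eta> * (V\<^sub>o s - g)"
      using step_pos Q_le_Q_opt[of "\<pi> k" s a] by (simp add: g_def)
    then show ?thesis using l(2)[OF pos] low[OF k] by (simp add: algebra_simps)
  qed
  have pos: "0 < \<eta> * (g / 2)" using step_pos g by simp
  have "\<exists>k0\<ge>Suc K. pmf (\<pi> k0 s) a = 0"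
  proof (rule ccontr)
    assume no: "\<not> ?thesis"
    have "0 < pmf (\<pi> (Suc k) s) a" if "K \<le> k" for k
    proof -
      have "Suc K \<le> Suc k" using that by simp
      then have "pmf (\<pi> (Suc k) s) a \<noteq> 0" using no by blast
      then show ?thesis using pmf_nonneg[of "\<pi> (Suc k) s" a] by linarith
    qed
    then show False
      by (intro no_uniform_descent[OF pos, of K "d 0" "\<lambda>k. d (pmf (\<pi> k s) a)"] desc d_prob_ge)
  qed
  then obtain k0 where k0: "Suc K \<le> k0" "pmf (\<pi> k0 s) a = 0" by blast
  have "pmf (\<pi> k s) a = 0" if "k0 \<le> k" for k
    using that
  proof (induction rule: dec_induct)
    case (step n)
    show ?case
    proof (rule ccontr)
      assume "pmf (\<pi> (Suc n) s) a \<noteq> 0"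
      then have "0 < pmf (\<pi> (Suc n) s) a" using pmf_nonneg[of "\<pi> (Suc n) s" a] by linarith
      from desc[OF _ this] have "d (pmf (\<pi> (Suc n) s) a) \<le> d 0 - \<eta> * (g / 2)"
        using step k0 by simp
      then show False using pos d_prob_ge[of "Suc n" s a] by linarith
    qed
  qed (rule k0)
  then show ?thesis unfolding eventually_sequentially by blast
qed

lemma subopt_mass_eliminated:
  assumes "card (A\<^sub>o s) \<noteq> 1"
  shows "\<forall>\<^sub>F k in sequentially. subopt_mass (\<pi> k) s = 0"
proof -
  obtain b\<^sub>1 b\<^sub>2 where b: "b\<^sub>1 \<in> A\<^sub>o s" "b\<^sub>2 \<in> A\<^sub>o s" "b\<^sub>1 \<noteq> b\<^sub>2"
    using assms opt_actions_nonempty[of s] by (metis is_singletonI' is_singleton_altdef)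
  have "\<forall>\<^sub>F k in sequentially. \<forall>a\<in>- A\<^sub>o s. pmf (\<pi> k s) a = 0"
    by (rule eventually_ball_finite) (use subopt_eliminated[OF b] in auto)
  then show ?thesis by eventually_elim simp
qed

text \<open>The multiplier lies close to \<open>\<eta>\<close> times the second best action value.  If it were larger, every
suboptimal action, whose dual variable is already close to \<open>d 0\<close>, would be cut off to
probability zero and \<open>b\<close> would get probability one, which is impossible.  If it were smaller,
the dual variable of the second best action would rise noticeably above \<open>d 0\<close>.  The dual
variable of \<open>b\<close> therefore moves by \<open>\<eta>\<close> times the gap of the state, up to the error.\<close>

lemma unique_opt_increment:
  assumes opt: "A\<^sub>o s = {b}" and two: "A\<^sub>o s \<noteq> UNIV" and \<sigma>: "0 < \<sigma>"
  shows "\<forall>\<^sub>F k in sequentially.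
      d (pmf (\<pi> k s) b) + \<eta> * (state_gap P r \<gamma> s - 2 * \<sigma>) \<le> d (pmf (\<pi> (Suc k) s) b) \<and>
      d (pmf (\<pi> (Suc k) s) b) \<le> d (pmf (\<pi> k s) b) + \<eta> * (state_gap P r \<gamma> s + 2 * \<sigma>)"
proof -
  let ?\<Delta> = "state_gap P r \<gamma> s"
  obtain l where
    l: "\<And>k s b. d (pmf (\<pi> k s) b) + \<eta> * Q (\<pi> k) s b - l k s \<le> d (pmf (\<pi> (Suc k) s) b)"
       "\<And>k s b. 0 < pmf (\<pi> (Suc k) s) b \<Longrightarrow>
       d (pmf (\<pi> (Suc k) s) b) = d (pmf (\<pi> k s) b) + \<eta> * Q (\<pi> k) s b - l k s"
    using dual_steps by blast
  obtain a1 where a1: "a1 \<notin> A\<^sub>o s" "V\<^sub>o s - Q\<^sub>o s a1 = ?\<Delta>"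
    using state_gap_attained[OF two] .
  have Qb: "Q\<^sub>o s b = V\<^sub>o s" using opt by (auto simp: opt_actions_def)
  have \<eta>\<sigma>: "0 < \<eta> * \<sigma>" using step_pos \<sigma> by simp
  have near0: "\<forall>\<^sub>F k in sequentially. \<forall>a\<in>- A\<^sub>o s. d (pmf (\<pi> k s) a) < d 0 + \<eta> * \<sigma>"
    by (rule eventually_ball_finite)
       (use order_tendstoD(2)[OF subopt_dual_tendsto] \<eta>\<sigma> in auto)
  have near0': "\<forall>\<^sub>F k in sequentially. \<forall>a\<in>- A\<^sub>o s. d (pmf (\<pi> (Suc k) s) a) < d 0 + \<eta> * \<sigma>"
    using near0 by (rule eventually_sequentially_Suc[THEN iffD2])
  have bpos: "\<forall>\<^sub>F k in sequentially. 0 < pmf (\<pi> (Suc k) s) b"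
  proof -
    have "\<forall>\<^sub>F k in sequentially. subopt_mass (\<pi> k) s < 1"
      using order_tendstoD(2)[OF subopt_mass_tendsto, of 1] by simp
    then have "\<forall>\<^sub>F k in sequentially. 0 < pmf (\<pi> k s) b"
    proof eventually_elim
      case (elim k)
      then show ?case using opt_mass[of "\<pi> k" s] opt by simp
    qed
    then show ?thesis by (rule eventually_sequentially_Suc[THEN iffD2])
  qed
  have Qb_near: "\<forall>\<^sub>F k in sequentially. V\<^sub>o s - \<sigma> < Q (\<pi> k) s b"
    using order_tendstoD(1)[OF Q_tendsto] Qb \<sigma> by simp
  have Qa1_near: "\<forall>\<^sub>F k in sequentially. V\<^sub>o s - ?\<Delta> - \<sigma> < Q (\<pi> k) s a1"
    using order_tendstoD(1)[OF Q_tendsto, of _ s a1] a1(2) \<sigma> by simp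
  show ?thesis
    using near0 near0' bpos Qb_near Qa1_near
  proof eventually_elim
    case (elim k)
    have eq: "d (pmf (\<pi> (Suc k) s) b) = d (pmf (\<pi> k s) b) + \<eta> * Q (\<pi> k) s b - l k s"
      using l(2) elim by blast
    have "l k s \<le> \<eta> * (V\<^sub>o s - ?\<Delta> + \<sigma>)"
    proof (rule ccontr)
      assume "\<not> ?thesis"
      then have big: "\<eta> * (V\<^sub>o s - ?\<Delta> + \<sigma>) < l k s" by simp
      have "pmf (\<pi> (Suc k) s) a = 0" if a: "a \<in> - A\<^sub>o s" for a
      proof (rule ccontr)
        assume "pmf (\<pi> (Suc k) s) a \<noteq> 0"
        then have "0 < pmf (\<pi> (Suc k) s) a" using pmf_nonneg[of "\<pi> (Suc k) s" a] by linarith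
        from l(2)[OF this]
        have 1: "d (pmf (\<pi> (Suc k) s) a) = d (pmf (\<pi> k s) a) + \<eta> * Q (\<pi> k) s a - l k s" .
        have "Q (\<pi> k) s a \<le> V\<^sub>o s - ?\<Delta>"
          using Q_le_Q_opt[of "\<pi> k" s a] state_gap_le[of a s] a by simp
        then have "\<eta> * Q (\<pi> k) s a \<le> \<eta> * (V\<^sub>o s - ?\<Delta>)"
          using step_pos by simp
        moreover have "d (pmf (\<pi> k s) a) < d 0 + \<eta> * \<sigma>" using elim a by blast
        ultimately show False
          using 1 big d_prob_ge[of "Suc k" s a] by (simp add: algebra_simps)
      qed
      then have "subopt_mass (\<pi> (Suc k)) s = 0" by simp
      then show False
        using opt_mass[of "\<pi> (Suc k)" s] opt less_1[of "Suc k" s b] by simp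
    qed
    moreover have "\<eta> * (V\<^sub>o s - \<sigma>) \<le> \<eta> * Q (\<pi> k) s b"
      using elim step_pos by simp
    ultimately have lower: "d (pmf (\<pi> k s) b) + \<eta> * (?\<Delta> - 2 * \<sigma>) \<le> d (pmf (\<pi> (Suc k) s) b)"
      using eq by (simp add: algebra_simps)
    have "d (pmf (\<pi> (Suc k) s) a1) < d 0 + \<eta> * \<sigma>" using elim a1 by blast
    moreover have "\<eta> * (V\<^sub>o s - ?\<Delta> - \<sigma>) \<le> \<eta> * Q (\<pi> k) s a1"
      using elim step_pos by simp
    moreover have "\<eta> * Q (\<pi> k) s b \<le> \<eta> * V\<^sub>o s"
      using step_pos Q_le_Q_opt[of "\<pi> k" s b] Qb by simp
    ultimately have "d (pmf (\<pi> (Suc k) s) b) \<le> d (pmf (\<pi> k s) b) + \<eta> * (?\<Delta> + 2 * \<sigma>)"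
      using eq l(1)[of k s a1] d_prob_ge[of k s a1] by (simp add: algebra_simps)
    with lower show ?case by simp
  qed
qed

lemma unique_opt_growth:
  assumes opt: "A\<^sub>o s = {b}" and two: "A\<^sub>o s \<noteq> UNIV" and \<sigma>: "0 < \<sigma>"
  obtains C C' where "\<forall>\<^sub>F k in sequentially.
      real k * \<eta> * (state_gap P r \<gamma> s - 2 * \<sigma>) + C \<le> d (pmf (\<pi> k s) b) \<and>
      d (pmf (\<pi> k s) b) \<le> real k * \<eta> * (state_gap P r \<gamma> s + 2 * \<sigma>) + C'"
proof -
  let ?\<Delta> = "state_gap P r \<gamma> s" and ?z = "\<lambda>k. d (pmf (\<pi> k s) b)"
  obtain K where K: "\<And>k. K \<le> k \<Longrightarrow> ?z k + \<eta> * (?\<Delta> - 2 * \<sigma>) \<le> ?z (Suc k)"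
      "\<And>k. K \<le> k \<Longrightarrow> ?z (Suc k) \<le> ?z k + \<eta> * (?\<Delta> + 2 * \<sigma>)"
    using unique_opt_increment[OF assms] unfolding eventually_sequentially by blast
  show thesis
  proof (rule that)
    show "\<forall>\<^sub>F k in sequentially.
      real k * \<eta> * (?\<Delta> - 2 * \<sigma>) + (?z K - real K * (\<eta> * (?\<Delta> - 2 * \<sigma>))) \<le> ?z k \<and>
      ?z k \<le> real k * \<eta> * (?\<Delta> + 2 * \<sigma>) + (?z K - real K * (\<eta> * (?\<Delta> + 2 * \<sigma>)))"
      unfolding eventually_sequentially
    proof (intro exI[of _ K] allI impI conjI)
      fix k assume k: "K \<le> k"
      show "real k * \<eta> * (?\<Delta> - 2 * \<sigma>) + (?z K - real K * (\<eta> * (?\<Delta> - 2 * \<sigma>))) \<le> ?z k"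
        using linear_growth(1)[of K ?z, OF K(1) k] by (simp add: algebra_simps)
      show "?z k \<le> real k * \<eta> * (?\<Delta> + 2 * \<sigma>) + (?z K - real K * (\<eta> * (?\<Delta> + 2 * \<sigma>)))"
        using linear_growth(2)[of K ?z, OF K(2) k] by (simp add: algebra_simps)
    qed
  qed
qed

end

lemma eventually_ge_affine:
  fixes c :: real assumes "0 < c" shows "\<forall>\<^sub>F k in sequentially. B \<le> real k * c + C"
proof -
  have "filterlim (\<lambda>k. real k * c + C) at_top sequentially"
    using assms by real_asymp
  then show ?thesis by (simp add: filterlim_at_top)
qed

section \<open>Two-sided bounds on the value error\<close>

theorem theorem3p14:
  fixes P :: "'s::finite \<Rightarrow> 'a::finite \<Rightarrow> 's pmf"
    and r :: "'s \<Rightarrow> 'a \<Rightarrow> real"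
    and \<gamma> \<eta> :: real
    and \<psi> :: "real \<Rightarrow> ereal"
    and \<pi> :: "nat \<Rightarrow> ('s, 'a) policy"
  assumes "\<And>s a. 0 \<le> r s a \<and> r s a \<le> 1"
    and "0 \<le> \<gamma>" and "\<gamma> < 1"
    and "nontrivial_states P r \<gamma> \<noteq> {}"
    and "mirror_potential \<psi>"
    and "0 < \<eta>"
    and "pmd_sequence P r \<gamma> \<psi> \<eta> \<pi>"
    and "psi_deriv_0p \<psi> > -\<infinity>"
    and "psi_deriv_1m \<psi> = \<infinity>"
    and "unique_opt_states P r \<gamma> \<noteq> {}"
  shows "continuous_on {0<..1} (chi \<psi>) \<and>
    strict_antimono_on {0<..1} (chi \<psi>) \<and>
    chi \<psi> ` {0<..1} = {y. psi_deriv_0p \<psi> \<le> ereal y} \<and>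
    (\<forall>\<sigma>. 0 < \<sigma> \<and> \<sigma> < gap P r \<gamma> / 2 \<longrightarrow>
      (\<exists>(T1::nat) (T2::nat) (C1::real) (C2::real).
        (\<forall>k\<ge>T1.
          real k * \<eta> * (unique_gap P r \<gamma> - 2 * \<sigma>) + C1 \<in> chi \<psi> ` {0<..1} \<and>
          max_norm (\<lambda>s. V_opt P r \<gamma> s - V_fun P r \<gamma> (\<pi> k) s)
            \<le> 1 / (1 - \<gamma>)\<^sup>2 * chi_inv \<psi> (real k * \<eta> * (unique_gap P r \<gamma> - 2 * \<sigma>) + C1)) \<and>
        (\<forall>k\<ge>T2.
          real k * \<eta> * (unique_gap P r \<gamma> + 2 * \<sigma>) + C2 \<in> chi \<psi> ` {0<..1} \<and>
          max_norm (\<lambda>s. V_opt P r \<gamma> s - V_fun P r \<gamma> (\<pi> k) s)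
            \<ge> gap P r \<gamma> * chi_inv \<psi> (real k * \<eta> * (unique_gap P r \<gamma> + 2 * \<sigma>) + C2))))"
proof -
  interpret psi: mirror_psi \<psi>
    by standard fact+
  interpret finite_mdp P r \<gamma>
    by standard fact+
  have "\<not> (\<forall>a a' :: 'a. a = a')"
    using assms(4) single_action_opt unfolding nontrivial_states_def by auto
  then obtain a\<^sub>1 a\<^sub>2 :: 'a where two: "a\<^sub>1 \<noteq> a\<^sub>2"
    by blast
  have init: "pmf (\<pi> 0 s) a \<in> psi.dom\<^sub>i" for s a
    using assms(7) by (simp add: pmd_sequence_def)
  have argmax: "is_arg_max (pmd_objective P r \<gamma> \<psi> \<eta> (\<pi> k) s) (\<lambda>_. True) (\<pi> (Suc k) s)" for k s
    using assms(7) by (simp add: pmd_sequence_def)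
  have less_1: "pmf (\<pi> k s) a < 1" for k s a
  proof (induction k arbitrary: s a)
    case 0
    have "pmf (\<pi> 0 s) a \<noteq> 1" using init[of s a] psi.one_not_int by metis
    then show ?case using pmf_le_1[of "\<pi> 0 s" a] by linarith
  next
    case (Suc k)
    show ?case by (rule psi.pmd_step(1)[OF Suc argmax two])
  qed
  interpret pmd_run P r \<gamma> psi.f psi.d \<eta> \<pi>
    by standard (use assms(6) less_1 psi.pmd_step(2)[OF less_1 argmax two] in auto)
  let ?U = "unique_opt_states P r \<gamma>" and ?N = "nontrivial_states P r \<gamma>"
  let ?D = "unique_gap P r \<gamma>" and ?gap = "gap P r \<gamma>"
  let ?err = "\<lambda>k. max_norm (\<lambda>s. V\<^sub>o s - V (\<pi> k) s)"
  have image: "chi \<psi> ` {0<..1} = {psi.d 0..}"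
    by (rule psi.chi_image)
  have image': "chi \<psi> ` {0<..1} = {y. psi_deriv_0p \<psi> \<le> ereal y}"
    unfolding image psi.deriv_0p by auto
  have unique: "\<exists>b. A\<^sub>o s = {b}" if "s \<in> ?U" for s
    using that by (simp add: unique_opt_states_def card_1_singleton_iff)
  then obtain best where best: "\<And>s. s \<in> ?U \<Longrightarrow> A\<^sub>o s = {best s}"
    by metis
  have not_all: "A\<^sub>o s \<noteq> UNIV" if "s \<in> ?U" for s
    using best[OF that] two by (metis UNIV_I singletonD)
  then have gap_le: "?gap \<le> state_gap P r \<gamma> s" if "s \<in> ?U" for s
    using that unfolding gap_def by (intro Min_le) (auto simp: nontrivial_states_def)
  have D_le: "?D \<le> state_gap P r \<gamma> s" if "s \<in> ?U" for s
    using that unfolding unique_gap_def by (intro Min_le) auto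
  have "?D \<in> state_gap P r \<gamma> ` ?U"
    unfolding unique_gap_def using assms(10) by (intro Min_in) auto
  then obtain s0 where s0: "s0 \<in> ?U" "state_gap P r \<gamma> s0 = ?D" by auto
  have mass: "subopt_mass (\<pi> k) s = chi_inv \<psi> (psi.d (pmf (\<pi> k s) (best s)))" if "s \<in> ?U" for k s
  proof -
    have "pmf (\<pi> k s) (best s) = 1 - subopt_mass (\<pi> k) s"
      using opt_mass[of "\<pi> k" s] best[OF that] by simp
    moreover have "chi_inv \<psi> (psi.d (pmf (\<pi> k s) (best s))) = 1 - pmf (\<pi> k s) (best s)"
      by (rule psi.chi_inv_d) (auto simp: less_1)
    ultimately show ?thesis by linarith
  qed
  have err_le: "?err k \<le> e" if "\<And>s. V\<^sub>o s - V (\<pi> k) s \<le> e" for k e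
    unfolding max_norm_def using that V_le_V_opt by (intro Max.boundedI) auto
  have err_ge: "V\<^sub>o s - V (\<pi> k) s \<le> ?err k" for k s
    unfolding max_norm_def by (rule order_trans[OF abs_ge_self]) (intro Max_ge, auto)
  have rates: "\<exists>T1 T2 C1 C2.
        (\<forall>k\<ge>T1.
          real k * \<eta> * (?D - 2 * \<sigma>) + C1 \<in> chi \<psi> ` {0<..1} \<and>
          ?err k \<le> 1 / (1 - \<gamma>)\<^sup>2 * chi_inv \<psi> (real k * \<eta> * (?D - 2 * \<sigma>) + C1)) \<and>
        (\<forall>k\<ge>T2.
          real k * \<eta> * (?D + 2 * \<sigma>) + C2 \<in> chi \<psi> ` {0<..1} \<and>
          ?gap * chi_inv \<psi> (real k * \<eta> * (?D + 2 * \<sigma>) + C2) \<le> ?err k)"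
    if \<sigma>: "0 < \<sigma>" "\<sigma> < ?gap / 2" for \<sigma>
  proof -
    have D: "0 < ?D - 2 * \<sigma>" "0 < ?gap"
      using \<sigma> gap_le[OF s0(1)] s0(2) by linarith+
    have "\<forall>s\<in>?U. \<exists>C C'. \<forall>\<^sub>F k in sequentially.
        real k * \<eta> * (state_gap P r \<gamma> s - 2 * \<sigma>) + C \<le> psi.d (pmf (\<pi> k s) (best s)) \<and>
        psi.d (pmf (\<pi> k s) (best s)) \<le> real k * \<eta> * (state_gap P r \<gamma> s + 2 * \<sigma>) + C'"
    proof
      fix s assume s: "s \<in> ?U"
      show "\<exists>C C'. \<forall>\<^sub>F k in sequentially.
        real k * \<eta> * (state_gap P r \<gamma> s - 2 * \<sigma>) + C \<le> psi.d (pmf (\<pi> k s) (best s)) \<and>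
        psi.d (pmf (\<pi> k s) (best s)) \<le> real k * \<eta> * (state_gap P r \<gamma> s + 2 * \<sigma>) + C'"
        by (rule unique_opt_growth[OF best[OF s] not_all[OF s] \<sigma>(1)]) (intro exI)
    qed
    from bchoice[OF this] obtain C where "\<forall>s\<in>?U. \<exists>C'. \<forall>\<^sub>F k in sequentially.
        real k * \<eta> * (state_gap P r \<gamma> s - 2 * \<sigma>) + C s \<le> psi.d (pmf (\<pi> k s) (best s)) \<and>
        psi.d (pmf (\<pi> k s) (best s)) \<le> real k * \<eta> * (state_gap P r \<gamma> s + 2 * \<sigma>) + C'" ..
    from bchoice[OF this] obtain C' where C: "\<And>s. s \<in> ?U \<Longrightarrow> \<forall>\<^sub>F k in sequentially.
        real k * \<eta> * (state_gap P r \<gamma> s - 2 * \<sigma>) + C s \<le> psi.d (pmf (\<pi> k s) (best s)) \<and>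
        psi.d (pmf (\<pi> k s) (best s)) \<le> real k * \<eta> * (state_gap P r \<gamma> s + 2 * \<sigma>) + C' s"
      by (elim exE) (rule that, erule bspec)
    \<comment> \<open>One constant must serve all states with a unique optimal action.\<close>
    define C1 where "C1 = Min (C ` ?U)"
    have C1: "C1 \<le> C s" if "s \<in> ?U" for s
      unfolding C1_def using that by (intro Min_le) auto
    let ?y = "\<lambda>k. real k * \<eta> * (?D - 2 * \<sigma>) + C1"
    let ?y' = "\<lambda>k. real k * \<eta> * (?D + 2 * \<sigma>) + C' s0"
    \<comment> \<open>The slope is positive because \<open>2 * \<sigma>\<close> is below the gap, so the argument of
        \<open>chi_inv\<close> eventually enters its range.\<close>
    have y_range: "\<forall>\<^sub>F k in sequentially. psi.d 0 \<le> ?y k"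
      using eventually_ge_affine[of "\<eta> * (?D - 2 * \<sigma>)" "psi.d 0" C1] D assms(6)
      by (simp add: mult.assoc)
    have "\<forall>s. \<forall>\<^sub>F k in sequentially. subopt_mass (\<pi> k) s \<le> chi_inv \<psi> (?y k)"
    proof
      fix s
      show "\<forall>\<^sub>F k in sequentially. subopt_mass (\<pi> k) s \<le> chi_inv \<psi> (?y k)"
      proof (cases "s \<in> ?U")
        case True
        show ?thesis
          using C[OF True] y_range
        proof eventually_elim
          case (elim k)
          have "real k * \<eta> * (?D - 2 * \<sigma>) \<le> real k * \<eta> * (state_gap P r \<gamma> s - 2 * \<sigma>)"
            using D_le[OF True] assms(6) by (intro mult_left_mono) auto
          then have "?y k \<le> psi.d (pmf (\<pi> k s) (best s))"
            using elim C1[OF True] by linarith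
          then show ?case
            unfolding mass[OF True] using elim by (intro psi.chi_inv_antimono) auto
        qed
      next
        case False
        then have "card (A\<^sub>o s) \<noteq> 1" by (simp add: unique_opt_states_def)
        from subopt_mass_eliminated[OF this] y_range show ?thesis
        proof eventually_elim
          case (elim k)
          then show ?case using psi.chi_inv_pos[of "?y k"] by simp
        qed
      qed
    qed
    then have "\<forall>\<^sub>F k in sequentially. \<forall>s. subopt_mass (\<pi> k) s \<le> chi_inv \<psi> (?y k)"
      by (intro eventually_all_finite) simp
    with y_range have "\<forall>\<^sub>F k in sequentially. ?y k \<in> chi \<psi> ` {0<..1} \<and>
        ?err k \<le> 1 / (1 - \<gamma>)\<^sup>2 * chi_inv \<psi> (?y k)"
    proof eventually_elim
      case (elim k)
      then show ?case
        using err_le[OF value_gap_upper, of k "chi_inv \<psi> (?y k)"] image by simp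
    qed
    moreover have "\<forall>\<^sub>F k in sequentially. ?y' k \<in> chi \<psi> ` {0<..1} \<and>
        ?gap * chi_inv \<psi> (?y' k) \<le> ?err k"
      using C[OF s0(1)]
    proof eventually_elim
      case (elim k)
      then have le: "psi.d (pmf (\<pi> k s0) (best s0)) \<le> ?y' k"
        by (simp add: s0(2))
      have "?gap * chi_inv \<psi> (?y' k) \<le> ?gap * subopt_mass (\<pi> k) s0"
        unfolding mass[OF s0(1)]
        using D(2) by (intro mult_left_mono psi.chi_inv_antimono le d_prob_ge) auto
      also have "\<dots> \<le> (\<Sum>a\<in>- A\<^sub>o s0. pmf (\<pi> k s0) a * (V\<^sub>o s0 - Q\<^sub>o s0 a))"
        unfolding sum_distrib_left
      proof (rule sum_mono)
        fix a assume "a \<in> - A\<^sub>o s0"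
        then have "?gap \<le> V\<^sub>o s0 - Q\<^sub>o s0 a"
          using gap_le[OF s0(1)] state_gap_le[of a s0] by simp
        then show "?gap * pmf (\<pi> k s0) a \<le> pmf (\<pi> k s0) a * (V\<^sub>o s0 - Q\<^sub>o s0 a)"
          by (subst mult.commute) (intro mult_left_mono, auto)
      qed
      also have "\<dots> \<le> ?err k"
        by (rule order_trans[OF value_gap_lower err_ge])
      finally show ?case
        using order_trans[OF d_prob_ge le] image by simp
    qed
    ultimately show ?thesis
      unfolding eventually_sequentially by blast
  qed
  show ?thesis
    using psi.chi_continuous psi.chi_strict_antimono image' rates by blast
qed

end
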